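(* Let $\mathcal{T}$ be a spherically symmetric rooted tree whose branching numbers are all prime (possibly distinct for distinct levels), and let $G$ be a finitely generated saturated weakly branch group on $\mathcal{T}$, acting level-transitively, which is weakly stabilizer transitive (WST). Suppose moreover that there are infinitely many $i$ such that $G_{\{v\}}$ acts transitively on the immediate descendants of $v$ for $v\in L_{i-1}$ and the group $\Gamma_{\{i\}}$ is not abelian. Then $G$ is an $R_\infty$ group.
   Context: A rooted tree $\mathcal{T}$ is spherically symmetric if all vertices of the same level have the same number of immediate descendants, called the branching number (index) of that level. $L_n$ denotes the $n$-th level of $\mathcal{T}$, $\mathcal{T}_v$ the subtree with root vertex $v$ consisting of $v$ and all its descendants, and $D(v)$ the set of immediate descendants of $v$. Groups act on $\mathcal{T}$ by automorphisms (isometries) of the rooted tree; an action is level-transitive if it is transitive on every level. $\operatorname{St}(v)$ denotes the stabilizer in $G$ of a vertex $v$, and $\operatorname{St}_j=\bigcap_{v\in L_j}\operatorname{St}(v)$. A group $G$ acting faithfully on $\mathcal{T}$ is a weakly branch group if for every vertex $v$ of $\mathcal{T}$ there exists an element of $G$ which acts nontrivially on $\mathcal{T}_v$ and trivially outside $\mathcal{T}_v$. $G$ is saturated if for every positive integer $n$ there exists a characteristic subgroup $H_n\subset G$ which acts trivially on $L_n$ and acts level transitively on every subtree $\mathcal{T}_v$ with $v\in L_n$. For a vertex $v\in L_j$, $G_{\{v\}}$ denotes the subgroup of all elements of $G$ fixing $v$ and fixing all vertices of the next level $L_{j+1}$ except possibly the immediate descendants of $v$; that is, $G_{\{v\}}=\bigcap_{w\in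 L_j,\,w\ne v}\ \bigcap_{u\in D(w)}\operatorname{St}(u)$. $G$ is weakly stabilizer transitive (WST) if for every vertex $v$ of $\mathcal{T}$ there is a vertex $v_0\in\mathcal{T}_v$ such that $G_{\{v_0\}}$ acts transitively on the set of immediate descendants of $v_0$. (When $G$ acts level-transitively, whether $G_{\{v\}}$ acts transitively on $D(v)$ depends only on the level of $v$.) Let $p_i:G\to G/\operatorname{St}_i$ be the natural projection. Then $\Gamma_{\{i\}}:=\prod_{v\in L_{i-1}}p_i(G_{\{v\}})$, the product being taken inside $G/\operatorname{St}_i$ (the factors pairwise commute). For an automorphism $\phi:G\to G$, the Reidemeister number $R(\phi)$ is the number of equivalence classes of the relation $g\sim hg\phi(h^{-1})$, $g,h\in G$. $G$ is an $R_\infty$ group if $R(\phi)=\infty$ for every automorphism $\phi$ of $G$. *)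

theory Defs
  imports
    "HOL-Algebra.Group_Action"
    "HOL-Algebra.Generated_Groups"
    "HOL-Computational_Algebra.Primes"
    "HOL-Library.Extended_Nat"
begin

section \<open>Rooted trees\<close>

text \<open>
  A rooted tree is encoded by its vertex set, its root and the map sending each vertex to its
  immediate predecessor. By convention the root is its own parent.
\<close>

record 'v rtree =
  verts :: "'v set"
  root :: 'v
  parent :: "'v \<Rightarrow> 'v"

definition rooted_tree :: "'v rtree \<Rightarrow> bool" where
  "rooted_tree T \<longleftrightarrow>
     root T \<in> verts T \<and>
     parent T ` verts T \<subseteq> verts T \<and>
     parent T (root T) = root T \<and>
     (\<forall>v\<in>verts T. \<exists>n. (parent T ^^ n) v = root T)"

definition depth :: "'v rtree \<Rightarrow> 'v \<Rightarrow> nat" where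
  "depth T v = (LEAST n. (parent T ^^ n) v = root T)"

definition level :: "'v rtree \<Rightarrow> nat \<Rightarrow> 'v set" where
  "level T n = {v \<in> verts T. depth T v = n}"

definition children :: "'v rtree \<Rightarrow> 'v \<Rightarrow> 'v set" where
  "children T v = {u \<in> verts T. u \<noteq> root T \<and> parent T u = v}"

definition subtree :: "'v rtree \<Rightarrow> 'v \<Rightarrow> 'v set" where
  "subtree T v = {u \<in> verts T. \<exists>n. (parent T ^^ n) u = v}"

definition spherically_symmetric :: "'v rtree \<Rightarrow> (nat \<Rightarrow> nat) \<Rightarrow> bool" where
  "spherically_symmetric T b \<longleftrightarrow>
     (\<forall>n. \<forall>v\<in>level T n. finite (children T v) \<and> card (children T v) = b n)"

definition tree_automorphism :: "'v rtree \<Rightarrow> ('v \<Rightarrow> 'v) \<Rightarrow> bool" where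
  "tree_automorphism T f \<longleftrightarrow>
     bij_betw f (verts T) (verts T) \<and> f (root T) = root T \<and>
     (\<forall>v\<in>verts T. f (parent T v) = parent T (f v))"


section \<open>Groups acting on rooted trees\<close>

definition faithful_tree_action ::
  "'v rtree \<Rightarrow> ('g, 'm) monoid_scheme \<Rightarrow> ('g \<Rightarrow> 'v \<Rightarrow> 'v) \<Rightarrow> bool" where
  "faithful_tree_action T G \<phi> \<longleftrightarrow>
     faithful_action G (verts T) \<phi> \<and> (\<forall>g\<in>carrier G. tree_automorphism T (\<phi> g))"

definition transitive_on :: "('g \<Rightarrow> 'v \<Rightarrow> 'v) \<Rightarrow> 'g set \<Rightarrow> 'v set \<Rightarrow> bool" where
  "transitive_on \<phi> H A \<longleftrightarrow> (\<forall>x\<in>A. \<forall>y\<in>A. \<exists>h\<in>H. \<phi> h x = y)"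

text \<open>
  The levels of the subtree at \<open>v\<close> are the nonempty intersections of that subtree with the
  levels of the whole tree. The case \<open>v = root T\<close> is level-transitivity on the whole tree.
\<close>

definition level_transitive_on_subtree ::
  "'v rtree \<Rightarrow> ('g \<Rightarrow> 'v \<Rightarrow> 'v) \<Rightarrow> 'g set \<Rightarrow> 'v \<Rightarrow> bool" where
  "level_transitive_on_subtree T \<phi> H v \<longleftrightarrow>
     (\<forall>m. transitive_on \<phi> H (level T m \<inter> subtree T v))"

definition level_transitive ::
  "'v rtree \<Rightarrow> ('g, 'm) monoid_scheme \<Rightarrow> ('g \<Rightarrow> 'v \<Rightarrow> 'v) \<Rightarrow> bool" where
  "level_transitive T G \<phi> \<longleftrightarrow> (\<forall>m. transitive_on \<phi> (carrier G) (level T m))"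

definition level_stabilizer ::
  "'v rtree \<Rightarrow> ('g, 'm) monoid_scheme \<Rightarrow> ('g \<Rightarrow> 'v \<Rightarrow> 'v) \<Rightarrow> nat \<Rightarrow> 'g set" where
  "level_stabilizer T G \<phi> j = carrier G \<inter> (\<Inter>v\<in>level T j. stabilizer G \<phi> v)"

definition weakly_branch ::
  "'v rtree \<Rightarrow> ('g, 'm) monoid_scheme \<Rightarrow> ('g \<Rightarrow> 'v \<Rightarrow> 'v) \<Rightarrow> bool" where
  "weakly_branch T G \<phi> \<longleftrightarrow>
     faithful_tree_action T G \<phi> \<and>
     (\<forall>v\<in>verts T. \<exists>g\<in>carrier G.
        (\<exists>u\<in>subtree T v. \<phi> g u \<noteq> u) \<and> (\<forall>u\<in>verts T - subtree T v. \<phi> g u = u))"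

definition characteristic_subgroup :: "'g set \<Rightarrow> ('g, 'm) monoid_scheme \<Rightarrow> bool" where
  "characteristic_subgroup H G \<longleftrightarrow> subgroup H G \<and> (\<forall>\<alpha>\<in>iso G G. \<alpha> ` H = H)"

definition saturated ::
  "'v rtree \<Rightarrow> ('g, 'm) monoid_scheme \<Rightarrow> ('g \<Rightarrow> 'v \<Rightarrow> 'v) \<Rightarrow> bool" where
  "saturated T G \<phi> \<longleftrightarrow>
     (\<forall>n\<ge>1. \<exists>H. characteristic_subgroup H G \<and>
        (\<forall>h\<in>H. \<forall>v\<in>level T n. \<phi> h v = v) \<and>
        (\<forall>v\<in>level T n. level_transitive_on_subtree T \<phi> H v))"

text \<open>
  The group \<open>G\<^bsub>{v}\<^esub>\<close>: it fixes \<open>v\<close> and all vertices of the next level outside the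
  immediate descendants of \<open>v\<close>. Intersecting with the stabilizer of \<open>v\<close> is what keeps the
  set inside \<open>G\<close> when \<open>v\<close> is the root and the indexed intersection is empty.
\<close>

definition local_subgroup ::
  "'v rtree \<Rightarrow> ('g, 'm) monoid_scheme \<Rightarrow> ('g \<Rightarrow> 'v \<Rightarrow> 'v) \<Rightarrow> 'v \<Rightarrow> 'g set" where
  "local_subgroup T G \<phi> v =
     stabilizer G \<phi> v \<inter>
     (\<Inter>w\<in>level T (depth T v) - {v}. \<Inter>u\<in>children T w. stabilizer G \<phi> u)"

definition weakly_stabilizer_transitive ::
  "'v rtree \<Rightarrow> ('g, 'm) monoid_scheme \<Rightarrow> ('g \<Rightarrow> 'v \<Rightarrow> 'v) \<Rightarrow> bool" where
  "weakly_stabilizer_transitive T G \<phi> \<longleftrightarrow>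
     (\<forall>v\<in>verts T. \<exists>v0\<in>subtree T v. transitive_on \<phi> (local_subgroup T G \<phi> v0) (children T v0))"

definition level_quotient ::
  "'v rtree \<Rightarrow> ('g, 'm) monoid_scheme \<Rightarrow> ('g \<Rightarrow> 'v \<Rightarrow> 'v) \<Rightarrow> nat \<Rightarrow> 'g set monoid" where
  "level_quotient T G \<phi> i = G Mod (level_stabilizer T G \<phi> i)"

definition level_proj ::
  "'v rtree \<Rightarrow> ('g, 'm) monoid_scheme \<Rightarrow> ('g \<Rightarrow> 'v \<Rightarrow> 'v) \<Rightarrow> nat \<Rightarrow> 'g \<Rightarrow> 'g set" where
  "level_proj T G \<phi> i g = level_stabilizer T G \<phi> i #>\<^bsub>G\<^esub> g"

text \<open>
  The product over \<open>v \<in> L\<^bsub>i-1\<^esub>\<close> of the subgroups \<open>p\<^sub>i (G\<^bsub>{v}\<^esub>)\<close> of \<open>G / St\<^sub>i\<close>, used for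
  \<open>i \<ge> 1\<close>: all products of one element from each factor. The factors commute pairwise, so the
  order \<open>vs\<close> in which the level is enumerated is irrelevant.
\<close>

definition Gamma ::
  "'v rtree \<Rightarrow> ('g, 'm) monoid_scheme \<Rightarrow> ('g \<Rightarrow> 'v \<Rightarrow> 'v) \<Rightarrow> nat \<Rightarrow> 'g set set" where
  "Gamma T G \<phi> i =
     {foldr (\<lambda>a c. a \<otimes>\<^bsub>level_quotient T G \<phi> i\<^esub> c) (map x vs) \<one>\<^bsub>level_quotient T G \<phi> i\<^esub> | x vs.
        distinct vs \<and> set vs = level T (i - 1) \<and>
        (\<forall>v\<in>level T (i - 1). x v \<in> level_proj T G \<phi> i ` local_subgroup T G \<phi> v)}"

definition abelian_subset :: "('a, 'm) monoid_scheme \<Rightarrow> 'a set \<Rightarrow> bool" where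
  "abelian_subset Q A \<longleftrightarrow> (\<forall>a\<in>A. \<forall>b\<in>A. a \<otimes>\<^bsub>Q\<^esub> b = b \<otimes>\<^bsub>Q\<^esub> a)"


section \<open>Reidemeister numbers\<close>

definition finitely_generated_group :: "('g, 'm) monoid_scheme \<Rightarrow> bool" where
  "finitely_generated_group G \<longleftrightarrow>
     (\<exists>S. finite S \<and> S \<subseteq> carrier G \<and> generate G S = carrier G)"

definition twisted_conjugacy :: "('g, 'm) monoid_scheme \<Rightarrow> ('g \<Rightarrow> 'g) \<Rightarrow> ('g \<times> 'g) set" where
  "twisted_conjugacy G \<alpha> =
     {(g, g'). g \<in> carrier G \<and> g' \<in> carrier G \<and>
        (\<exists>h\<in>carrier G. g' = h \<otimes>\<^bsub>G\<^esub> g \<otimes>\<^bsub>G\<^esub> \<alpha> (inv\<^bsub>G\<^esub> h))}"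

definition reidemeister_number :: "('g, 'm) monoid_scheme \<Rightarrow> ('g \<Rightarrow> 'g) \<Rightarrow> enat" where
  "reidemeister_number G \<alpha> =
     (let C = carrier G // twisted_conjugacy G \<alpha> in if finite C then enat (card C) else \<infinity>)"

definition R_infinity_group :: "('g, 'm) monoid_scheme \<Rightarrow> bool" where
  "R_infinity_group G \<longleftrightarrow> (\<forall>\<alpha>\<in>iso G G. reidemeister_number G \<alpha> = \<infinity>)"

end

theory Submission
  imports Defs "HOL-Algebra.Sylow" "HOL-Algebra.Multiplicative_Group" "HOL-Combinatorics.Permutations"
begin

text \<open>
  Every automorphism \<open>\<alpha>\<close> of \<open>G\<close> is conjugation by an automorphism \<open>s\<close> of the tree, by a theorem
  of Lavreniuk and Nekrashevych (\<open>automorphism_induced\<close>). Hence \<open>g\<close> and \<open>g'\<close> are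
  \<open>\<alpha>\<close>-twisted conjugate if and only if the tree automorphisms \<open>g s\<close> and \<open>g' s\<close> are
  conjugate under \<open>G\<close>, and the task is to find infinitely many \<open>G\<close>-conjugacy classes in the
  coset \<open>G s\<close>. They are told apart by their actions on the finite levels of the tree.

  The main step (\<open>level_class_splits\<close>) concerns one level \<open>i\<close> of the kind occurring in the
  theorem. It gives an element \<open>e\<^sub>i\<close> of some \<open>G\<^bsub>{v}\<^esub>\<close>, \<open>v\<close> a vertex of level \<open>i - 1\<close>, such
  that \<open>s e\<^sub>i\<close> and \<open>s\<close>, which agree on level \<open>i - 1\<close>, are not conjugate under \<open>G\<close> on level
  \<open>i\<close>. For two such levels \<open>i < j\<close> the maps \<open>s e\<^sub>j\<close> and \<open>s\<close> agree on level \<open>i\<close>, so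
  \<open>s e\<^sub>i\<close> and \<open>s e\<^sub>j\<close> are not conjugate. As \<open>s e\<^sub>i = \<alpha>(e\<^sub>i) s\<close>, the elements
  \<open>\<alpha>(e\<^sub>i)\<close> lie in pairwise distinct twisted classes.

  To split a level, let \<open>c\<close> be the permutation of the \<open>p\<close> immediate descendants of \<open>v\<close> given by
  the first return of \<open>s\<close> to \<open>v\<close>, and let \<open>A\<close> be the group of permutations of these
  descendants induced by \<open>G\<^bsub>{v}\<^esub>\<close>; it is transitive, and \<open>c\<close> normalises it. Replacing \<open>s\<close>
  by \<open>s e\<close> replaces \<open>c\<close> by \<open>c a\<close>, where \<open>a\<close> is the image of \<open>e\<close> in \<open>A\<close>. If all these
  maps were conjugate to \<open>s\<close> on level \<open>i\<close>, then (\<open>first_return_conjugate\<close>) every element of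
  \<open>c A\<close> would be conjugate to \<open>c\<close> by a permutation normalising \<open>A\<close>. For a transitive group of
  prime degree this forces \<open>A\<close> to be abelian (\<open>abelian_if_coset_conjugate\<close>). But if all the
  groups induced by the \<open>G\<^bsub>{v}\<^esub>\<close> are abelian then so is their product \<open>\<Gamma>\<^bsub>{i}\<^esub>\<close>
  (\<open>Gamma_abelian_if_local_abelian\<close>), so on the levels in question \<open>v\<close> can be chosen with \<open>A\<close>
  not abelian.

  The statement about prime degree is the point where twisted conjugacy has to be controlled
  without knowing how \<open>\<alpha>\<close> acts. It is proved by Sylow theory: after a change of \<open>c\<close> within
  \<open>c A\<close>, it fixes a point and normalises a Sylow subgroup \<open>P\<close> of order \<open>p\<close>. Maps with these
  two properties are the multiplications of \<open>\<int>/p\<close>, so they commute. A Frattini argument then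
  turns conjugacy under the normaliser into conjugacy under \<open>A\<close>, so \<open>c\<close> commutes with no
  element of \<open>A\<close> other than the identity. Therefore \<open>P\<close> is its own normaliser in \<open>A\<close>, and
  counting the conjugates of \<open>P\<close> gives \<open>A = P\<close>.
\<close>

section \<open>Permutation groups of prime degree\<close>

lemma funpow_mult_fixed:
  assumes "(f ^^ m) x = x"
  shows "(f ^^ (k * m)) x = x"
  using assms by (induction k) (auto simp: funpow_add)

text \<open>
  By Bezout, a second period smaller than \<open>p\<close> together with the period \<open>p\<close> would make \<open>x\<close> a
  fixed point.
\<close>

lemma prime_period_inj:
  fixes p :: nat
  assumes "prime p" "(f ^^ p) x = x" "f x \<noteq> x"
  shows "inj_on (\<lambda>k. (f ^^ k) x) {..<p}"
proof -
  have "False" if ij: "i < j" "j < p" "(f ^^ i) x = (f ^^ j) x" for i j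
  proof -
    have "(f ^^ (p - i + j)) x = (f ^^ (p - i + i)) x"
      by (simp only: funpow_add comp_apply ij(3))
    also have "\<dots> = x" using ij assms by simp
    finally have "(f ^^ (p - i + j)) x = x" .
    moreover have "p - i + j = j - i + p" using ij by simp
    ultimately have "(f ^^ (j - i + p)) x = x" by simp
    then have d: "(f ^^ (j - i)) x = x" using assms by (simp add: funpow_add)
    have "\<not> p dvd (j - i)" using ij by (auto dest: dvd_imp_le)
    then have "coprime (j - i) p"
      using assms(1) by (metis coprime_commute prime_imp_coprime)
    then obtain a b where ab: "(j - i) * a = p * b + 1"
      using ij coprime_bezout_strong[of "j - i" p] assms(1) by (metis prime_nat_iff less_irrefl)
    have "x = (f ^^ (a * (j - i))) x" using funpow_mult_fixed[OF d] by simp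
    also have "\<dots> = f ((f ^^ (b * p)) x)" using ab by (simp add: mult.commute)
    also have "\<dots> = f x" using funpow_mult_fixed[OF assms(2)] by simp
    finally show False using assms(3) by simp
  qed
  then show ?thesis unfolding inj_on_def by (metis linorder_neqE_nat lessThan_iff)
qed

text \<open>
  The moved points fall into orbits of exactly \<open>p\<close> points each. This congruence replaces all
  orbit counting for groups of order \<open>p\<close> below.
\<close>

lemma prime_dvd_card_moved:
  fixes p :: nat
  assumes "prime p" "finite S" "\<And>x. x \<in> S \<Longrightarrow> f x \<in> S" "\<And>x. x \<in> S \<Longrightarrow> (f ^^ p) x = x"
  shows "p dvd card {x \<in> S. f x \<noteq> x}"
proof -
  have main: "p dvd card M" if "finite M" "\<And>x. x \<in> M \<Longrightarrow> f x \<in> M"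
    "\<And>x. x \<in> M \<Longrightarrow> (f ^^ p) x = x" "\<And>x. x \<in> M \<Longrightarrow> f x \<noteq> x" for M
    using that
  proof (induction M rule: finite_psubset_induct)
    case (psubset M)
    show ?case
    proof (cases "M = {}")
      case False
      then obtain x where x: "x \<in> M" by blast
      define Q where "Q = (\<lambda>k. (f ^^ k) x) ` {..<p}"
      have fk: "(f ^^ k) x \<in> M" for k using x psubset.prems(1) by (induction k) auto
      have cQ: "card Q = p"
        unfolding Q_def using prime_period_inj[of p f x] assms(1) psubset.prems x
        by (simp add: card_image)
      have QM: "Q \<subseteq> M" unfolding Q_def using fk by auto
      have pw: "(f ^^ k) x \<in> Q" for k
      proof -
        have "(f ^^ k) x = (f ^^ (k mod p + k div p * p)) x" by simp
        also have "\<dots> = (f ^^ (k mod p)) ((f ^^ (k div p * p)) x)"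
          by (simp only: funpow_add comp_apply)
        also have "\<dots> = (f ^^ (k mod p)) x"
          using funpow_mult_fixed psubset.prems(2) x by metis
        finally show ?thesis unfolding Q_def using assms(1) by (auto simp: prime_gt_0_nat)
      qed
      have stable: "f y \<in> M - Q" if y: "y \<in> M - Q" for y
      proof -
        have "y \<in> Q" if fy: "f y \<in> Q"
        proof -
          obtain k where k: "f y = (f ^^ k) x" using fy unfolding Q_def by auto
          have "y = (f ^^ p) y" using psubset.prems(2) y by simp
          also have "\<dots> = (f ^^ (p - 1)) (f y)"
            using assms(1) by (metis Suc_pred' comp_apply funpow_Suc_right prime_gt_0_nat)
          also have "\<dots> = (f ^^ (p - 1 + k)) x" by (simp add: k funpow_add)
          finally show "y \<in> Q" using pw by metis
        qed
        then show ?thesis using y psubset.prems(1) by auto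
      qed
      have "Q \<noteq> {}" using pw by auto
      then have "p dvd card (M - Q)"
        using psubset.IH[of "M - Q"] psubset.prems stable QM by blast
      moreover have "card M = card (M - Q) + p"
        using cQ QM psubset.hyps by (metis card_Diff_subset card_mono finite_subset le_add_diff_inverse2)
      ultimately show ?thesis by simp
    qed simp
  qed
  have "f (f x) \<noteq> f x" if "x \<in> S" "f x \<noteq> x" for x
  proof
    assume a: "f (f x) = f x"
    have "(f ^^ k) (f x) = f x" for k by (induction k) (auto simp: a)
    then have "(f ^^ p) x = f x"
      using assms(1) by (metis Suc_pred' comp_apply funpow_Suc_right prime_gt_0_nat)
    then show False using assms(4) that by simp
  qed
  then show ?thesis using assms by (intro main) auto
qed

text \<open>
  The usual notation for the inverse of a function denotes the inverse in a group here.
\<close>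

abbreviation (input) pinv :: "('a \<Rightarrow> 'b) \<Rightarrow> 'b \<Rightarrow> 'a"
  where "pinv f \<equiv> inv_into UNIV f"

locale perm_group =
  fixes D :: "'a set" and A :: "('a \<Rightarrow> 'a) set"
  assumes fin: "finite D"
    and perm: "a \<in> A \<Longrightarrow> a permutes D"
    and id_mem: "id \<in> A"
    and comp_mem: "a \<in> A \<Longrightarrow> b \<in> A \<Longrightarrow> a \<circ> b \<in> A"
    and inv_mem: "a \<in> A \<Longrightarrow> pinv a \<in> A"
begin

lemma finite_A: "finite A"
  by (rule finite_subset[OF _ finite_permutations[OF fin]]) (auto dest: perm)

lemma funpow_mem: "a \<in> A \<Longrightarrow> a ^^ k \<in> A"
  by (induction k) (use id_mem in \<open>auto simp: comp_mem id_def\<close>)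

lemma cancel_left: "a \<in> A \<Longrightarrow> a \<circ> f = a \<circ> g \<longleftrightarrow> f = g"
  using permutes_inj[OF perm] by (metis fun.inj_map_strong inj_on_def UNIV_I comp_apply ext)

lemma order_prime_exists:
  assumes "prime p" "p dvd card A"
  shows "\<exists>s\<in>A. s \<noteq> id \<and> s ^^ p = id"
proof -
  define G where "G = \<lparr>carrier = A, monoid.mult = (\<lambda>a b. a \<circ> b), one = id :: 'a \<Rightarrow> 'a\<rparr>"
  have G: "group G"
  proof (rule groupI)
    show "\<exists>y\<in>carrier G. y \<otimes>\<^bsub>G\<^esub> x = \<one>\<^bsub>G\<^esub>" if "x \<in> carrier G" for x
      using that inv_mem permutes_inv_o(2)[OF perm] unfolding G_def by auto
  qed (auto simp: G_def id_mem comp_mem o_assoc)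
  obtain m where "order G = p ^ 1 * m" using assms(2) by (auto simp: G_def order_def)
  then obtain H where H: "subgroup H G" "card H = p"
    using sylow_thm[OF assms(1) G, of 1 m] finite_A by (auto simp: G_def)
  have "1 < card H" using H prime_gt_1_nat[OF assms(1)] by simp
  then obtain s where s: "s \<in> H" "s \<noteq> id"
    by (metis card.empty card_1_singleton_iff is_singletonI' is_singleton_altdef less_irrefl
        not_less_zero)
  interpret GH: group "G\<lparr>carrier := H\<rparr>" using H G group.subgroup_imp_group by blast
  have "s [^]\<^bsub>G\<lparr>carrier := H\<rparr>\<^esub> p = \<one>\<^bsub>G\<^esub>"
    using GH.pow_order_eq_1[of s] s H by (simp add: order_def)
  moreover have "s [^]\<^bsub>G\<lparr>carrier := H\<rparr>\<^esub> (k::nat) = s ^^ k" for k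
    by (induction k) (simp_all add: G_def funpow_swap1 o_def fun_eq_iff)
  ultimately have "s ^^ p = id" by (simp add: G_def)
  moreover have "s \<in> A" using s H(1) subgroup.subset by (fastforce simp: G_def)
  ultimately show ?thesis using s by blast
qed

end

locale prime_degree_group = perm_group +
  fixes p :: nat
  assumes prime_p: "prime p" and card_D: "card D = p"
    and trans: "x \<in> D \<Longrightarrow> y \<in> D \<Longrightarrow> \<exists>a\<in>A. a x = y"
begin

definition stab where "stab d = {a \<in> A. a d = d}"

lemma p_pos: "0 < p" using prime_p prime_gt_0_nat by blast

text \<open>
  The number of moved points is a positive multiple of \<open>p\<close> and at most \<open>p\<close>, so \<open>s\<close> is a
  single \<open>p\<close>-cycle and \<open>D\<close> is identified with \<open>\<int>/p\<close> by \<open>k \<mapsto> s\<^sup>k d\<close>.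
\<close>

lemma order_p_orbit:
  assumes s: "s permutes D" "s \<noteq> id" "s ^^ p = id" and d: "d \<in> D"
  shows "bij_betw (\<lambda>k. (s ^^ k) d) {..<p} D"
proof -
  let ?M = "{x \<in> D. s x \<noteq> x}"
  have "p dvd card ?M"
    using prime_dvd_card_moved[OF prime_p fin, of s] s permutes_in_image[OF s(1)] by simp
  moreover have "?M \<noteq> {}"
  proof
    assume "?M = {}"
    then have "s x = x" for x using permutes_not_in[OF s(1)] by (cases "x \<in> D") auto
    then show False using s(2) by auto
  qed
  then have "card ?M > 0" using fin by (simp add: card_gt_0_iff)
  ultimately have "card D \<le> card ?M" using card_D by (simp add: dvd_imp_le)
  then have "?M = D" using fin by (intro card_seteq) auto
  then have "s d \<noteq> d" using d by auto
  then have inj: "inj_on (\<lambda>k. (s ^^ k) d) {..<p}"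
    using prime_period_inj[OF prime_p, of s d] s by simp
  have "(s ^^ k) d \<in> D" for k using d permutes_in_image[OF s(1)] by (induction k) auto
  then have "(\<lambda>k. (s ^^ k) d) ` {..<p} = D"
    using inj card_D fin by (intro card_subset_eq) (auto simp: card_image)
  with inj show ?thesis by (simp add: bij_betw_def)
qed

lemma order_p_transitive:
  assumes "s permutes D" "s \<noteq> id" "s ^^ p = id" "x \<in> D" "y \<in> D"
  obtains k where "k < p" "(s ^^ k) x = y"
proof -
  have "y \<in> (\<lambda>k. (s ^^ k) x) ` {..<p}"
    using order_p_orbit[OF assms(1-4)] assms(5) by (simp add: bij_betw_def)
  then show ?thesis using that by auto
qed

lemma order_p_semiregular:
  assumes "s permutes D" "s \<noteq> id" "s ^^ p = id" "d \<in> D" "(s ^^ k) d = d"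
  shows "p dvd k"
proof -
  have "(s ^^ k) d = (s ^^ (k mod p + k div p * p)) d" by simp
  also have "\<dots> = (s ^^ (k mod p)) ((s ^^ (k div p * p)) d)"
    by (simp only: funpow_add comp_apply)
  also have "\<dots> = (s ^^ (k mod p)) d"
    using funpow_mult_fixed[of p s d] assms(3) by simp
  finally have "(s ^^ (k mod p)) d = (s ^^ 0) d" using assms(5) by simp
  then have "k mod p = 0"
    using order_p_orbit[OF assms(1-4)] p_pos
    by (meson bij_betw_imp_inj_on inj_on_eq_iff lessThan_iff mod_less_divisor)
  then show ?thesis by auto
qed

lemma order_p_pow_dvd:
  assumes "s ^^ p = id" "p dvd k"
  shows "s ^^ k = id"
  using assms funpow_mult_fixed[of p s] by (auto simp: fun_eq_iff mult.commute elim!: dvdE)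

lemma order_p_pow_compl:
  assumes "s ^^ p = id" "k \<le> p"
  shows "s ^^ k \<circ> s ^^ (p - k) = id" "s ^^ (p - k) \<circ> s ^^ k = id"
  using assms by (simp_all flip: funpow_add)

lemma card_stab: "d \<in> D \<Longrightarrow> card A = p * card (stab d)"
proof -
  assume d: "d \<in> D"
  obtain t where t: "t e \<in> A" "t e d = e" if "e \<in> D" for e
    using trans[OF d] by metis
  have "bij_betw (\<lambda>(e, a). t e \<circ> a) (D \<times> stab d) A"
  proof (rule bij_betw_imageI)
    show "inj_on (\<lambda>(e, a). t e \<circ> a) (D \<times> stab d)"
    proof (rule inj_onI, clarify)
      fix e a e' a' assume h: "e \<in> D" "e' \<in> D" "a \<in> stab d" "a' \<in> stab d" "t e \<circ> a = t e' \<circ> a'"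
      have "t e (a d) = t e' (a' d)" using h by (metis comp_apply)
      then have "e = e'" using h t by (simp add: stab_def)
      then show "e = e' \<and> a = a'" using h t by (simp add: stab_def cancel_left)
    qed
    show "(\<lambda>(e, a). t e \<circ> a) ` (D \<times> stab d) = A"
    proof
      show "(\<lambda>(e, a). t e \<circ> a) ` (D \<times> stab d) \<subseteq> A"
        using t by (auto simp: stab_def comp_mem)
      show "A \<subseteq> (\<lambda>(e, a). t e \<circ> a) ` (D \<times> stab d)"
      proof
        fix a assume a: "a \<in> A"
        have e: "a d \<in> D" using a d perm permutes_in_image by metis
        note pt = permutes_inverses[OF perm[OF t(1)[OF e]]]
        have "pinv (t (a d)) (a d) = d" using t(2)[OF e] pt by metis
        then have "pinv (t (a d)) \<circ> a \<in> stab d"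
          using a t(1)[OF e] by (auto simp: stab_def intro: comp_mem inv_mem)
        moreover have "a = t (a d) \<circ> (pinv (t (a d)) \<circ> a)" using pt by (auto simp: fun_eq_iff)
        ultimately show "a \<in> (\<lambda>(e, a). t e \<circ> a) ` (D \<times> stab d)" using e by (intro image_eqI[of _ _ "(a d, pinv (t (a d)) \<circ> a)"]) auto
      qed
    qed
  qed
  then show "card A = p * card (stab d)"
    by (metis bij_betw_same_card card_D card_cartesian_product)
qed

lemma stab_perm_group: "perm_group D (stab d)"
proof
  show "pinv a \<in> stab d" if "a \<in> stab d" for a
    using that inv_mem permutes_inverses[OF perm] unfolding stab_def by (auto, metis)
qed (auto simp: stab_def fin perm id_mem comp_mem)

text \<open>
  An element of order \<open>p\<close> has no fixed points. Together with \<open>card_stab\<close> this says that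
  subgroups of order \<open>p\<close> are Sylow subgroups.
\<close>

lemma p_not_dvd_card_stab:
  assumes "d \<in> D" shows "\<not> p dvd card (stab d)"
proof
  assume "p dvd card (stab d)"
  then obtain s where s: "s \<in> stab d" "s \<noteq> id" "s ^^ p = id"
    using perm_group.order_prime_exists[OF stab_perm_group prime_p] by blast
  then have "(s ^^ 1) d = d" "s permutes D" by (auto simp: stab_def perm)
  then have "p dvd 1" using order_p_semiregular s assms by blast
  then show False using prime_p by auto
qed

text \<open>
  Conjugacy of the Sylow subgroups. The usual proof lets \<open>t\<close> act on the cosets of
  \<open>P = {s\<^sup>k | k}\<close> and finds a fixed coset because their number is prime to \<open>p\<close>. As \<open>P\<close> is
  regular, each coset contains exactly one element of the stabilizer of a point \<open>d\<close>, so the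
  action can be carried by this stabilizer instead.
\<close>

lemma order_p_conjugate:
  assumes s: "s \<in> A" "s \<noteq> id" "s ^^ p = id" and t: "t \<in> A" "t ^^ p = id"
  shows "\<exists>a\<in>A. \<exists>k. t \<circ> a = a \<circ> s ^^ k"
proof -
  obtain d where d: "d \<in> D" using card_D p_pos by fastforce
  note sp = perm[OF s(1)]
  \<comment> \<open>The representative of the coset \<open>t a P\<close> in the stabilizer of \<open>d\<close>.\<close>
  have "\<exists>k<p. (t \<circ> a \<circ> s ^^ k) d = d" if "a \<in> A" for a
  proof -
    have "t \<circ> a \<in> A" using that t comp_mem by simp
    then have P: "(t \<circ> a) permutes D" using perm by simp
    then have "pinv (t \<circ> a) d \<in> D" using d permutes_inv permutes_in_image by metis
    then obtain k where "k < p" "(s ^^ k) d = pinv (t \<circ> a) d"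
      using order_p_transitive[OF sp s(2,3) d] by metis
    then show ?thesis using permutes_inverses[OF P] by (intro exI[of _ k]) (metis comp_apply)
  qed
  then obtain \<kappa> where \<kappa>: "\<kappa> a < p" "(t \<circ> a \<circ> s ^^ \<kappa> a) d = d" if "a \<in> A" for a by metis
  define F where "F a = t \<circ> a \<circ> s ^^ \<kappa> a" for a
  have F: "F a \<in> stab d" if "a \<in> stab d" for a
    using that \<kappa> t s unfolding F_def stab_def by (auto intro!: comp_mem funpow_mem)
  have Fk: "(F ^^ k) a \<in> stab d \<and> (\<exists>m. (F ^^ k) a = t ^^ k \<circ> a \<circ> s ^^ m)" if "a \<in> stab d" for a k
  proof (induction k)
    case 0
    show ?case using that by (auto intro!: exI[of _ 0])
  next
    case (Suc k)
    then obtain m where m: "(F ^^ k) a = t ^^ k \<circ> a \<circ> s ^^ m" by blast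
    have "(F ^^ Suc k) a = t \<circ> (t ^^ k \<circ> a \<circ> s ^^ m) \<circ> s ^^ \<kappa> ((F ^^ k) a)"
      by (simp add: F_def m)
    also have "\<dots> = t ^^ Suc k \<circ> a \<circ> s ^^ (m + \<kappa> ((F ^^ k) a))"
      by (simp add: fun_eq_iff funpow_add)
    finally have "\<exists>m. (F ^^ Suc k) a = t ^^ Suc k \<circ> a \<circ> s ^^ m" by blast
    moreover have "(F ^^ Suc k) a \<in> stab d" using F[of "(F ^^ k) a"] Suc by simp
    ultimately show ?case by blast
  qed
  have Fp: "(F ^^ p) a = a" if a: "a \<in> stab d" for a
  proof -
    obtain m where m: "(F ^^ p) a = a \<circ> s ^^ m" using Fk[OF a, of p] t by auto
    then have "a ((s ^^ m) d) = d" using Fk[OF a, of p] by (auto simp: stab_def)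
    also have "d = a d" using a by (simp add: stab_def)
    finally have "(s ^^ m) d = d"
      using injD[OF permutes_inj[OF perm[of a]]] a unfolding stab_def by blast
    then have "p dvd m" using order_p_semiregular[OF sp s(2,3) d] by blast
    then show ?thesis using m order_p_pow_dvd[OF s(3)] by simp
  qed
  have "finite (stab d)" using finite_A by (simp add: stab_def)
  then have "p dvd card {a \<in> stab d. F a \<noteq> a}"
    using prime_dvd_card_moved[OF prime_p, of "stab d" F] F Fp by simp
  then have "{a \<in> stab d. F a \<noteq> a} \<noteq> stab d" using p_not_dvd_card_stab[OF d] by metis
  then obtain a where a: "a \<in> A" "F a = a" by (auto simp: stab_def)
  have "t \<circ> a = t \<circ> a \<circ> (s ^^ \<kappa> a \<circ> s ^^ (p - \<kappa> a))"
    using order_p_pow_compl[OF s(3)] \<kappa>(1)[OF a(1)] by simp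
  also have "\<dots> = F a \<circ> s ^^ (p - \<kappa> a)" by (simp add: F_def o_assoc)
  finally show ?thesis using a by auto
qed

definition normalises where
  "normalises n \<longleftrightarrow> n permutes D \<and> (\<forall>a\<in>A. \<exists>a'\<in>A. n \<circ> a = a' \<circ> n)"

lemma normalises_conj: "normalises n \<Longrightarrow> a \<in> A \<Longrightarrow> n \<circ> a \<circ> pinv n \<in> A"
  unfolding normalises_def
  by (metis comp_assoc comp_id permutes_inv_o(1))

text \<open>
  Conjugation by \<open>n\<close> is an injective map of the finite set \<open>A\<close> into itself.
\<close>

lemma normalises_conj_inv:
  assumes n: "normalises n" and a: "a \<in> A"
  shows "pinv n \<circ> a \<circ> n \<in> A"
proof -
  have pn: "n permutes D" using n by (simp add: normalises_def)
  have "inj_on (\<lambda>a. n \<circ> a \<circ> pinv n) A"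
  proof (rule inj_onI)
    fix x y assume "n \<circ> x \<circ> pinv n = n \<circ> y \<circ> pinv n"
    then have "pinv n \<circ> (n \<circ> x \<circ> pinv n) \<circ> n = pinv n \<circ> (n \<circ> y \<circ> pinv n) \<circ> n" by simp
    then show "x = y" using permutes_inverses[OF pn] by (simp add: fun_eq_iff)
  qed
  then have "(\<lambda>a. n \<circ> a \<circ> pinv n) ` A = A"
    using normalises_conj[OF n] finite_A by (intro endo_inj_surj) auto
  then obtain b where "b \<in> A" "a = n \<circ> b \<circ> pinv n" using a by auto
  then show ?thesis using permutes_inv_o[OF pn]
    by (metis comp_assoc comp_id id_comp)
qed

lemma funpow_intertwine:
  assumes "f \<circ> s = s ^^ k \<circ> f"
  shows "f \<circ> s ^^ m = s ^^ (k * m) \<circ> f"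
proof (induction m)
  case (Suc m)
  have "f \<circ> s ^^ Suc m = (f \<circ> s) \<circ> s ^^ m" by (simp add: o_assoc)
  also have "\<dots> = s ^^ k \<circ> (f \<circ> s ^^ m)" by (simp only: assms comp_assoc)
  also have "\<dots> = s ^^ (k * Suc m) \<circ> f" by (simp only: Suc funpow_add o_assoc mult_Suc_right)
  finally show ?case .
qed simp

text \<open>
  In the coordinate \<open>k \<mapsto> s\<^sup>k d\<close> on \<open>D\<close> both maps are multiplications of \<open>\<int>/p\<close>.
\<close>

lemma affine_commute:
  assumes s: "s permutes D" "s \<noteq> id" "s ^^ p = id"
    and d: "d \<in> D" and f: "f permutes D" "f d = d" "f \<circ> s = s ^^ k \<circ> f"
    and g: "g permutes D" "g d = d" "g \<circ> s = s ^^ l \<circ> g"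
  shows "f \<circ> g = g \<circ> f"
proof
  fix x show "(f \<circ> g) x = (g \<circ> f) x"
  proof (cases "x \<in> D")
    case True
    then obtain m where m: "x = (s ^^ m) d" using order_p_transitive[OF s d] by metis
    have F: "f ((s ^^ m) d) = (s ^^ (k * m)) d" for m
      using funpow_intertwine[OF f(3), of m] f(2) by (metis comp_apply)
    have Gg: "g ((s ^^ m) d) = (s ^^ (l * m)) d" for m
      using funpow_intertwine[OF g(3), of m] g(2) by (metis comp_apply)
    show ?thesis by (simp add: m F Gg mult.left_commute)
  next
    case False
    then show ?thesis using f g by (simp add: permutes_not_in)
  qed
qed

text \<open>
  The core of the argument on prime degree, for a \<open>c\<close> that fixes a point and normalises the Sylow
  subgroup \<open>P\<close> generated by \<open>s\<close>. By the Frattini argument a conjugating permutation \<open>n\<close> is a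
  product of an element of \<open>A\<close> and a multiplication \<open>q\<close>; the latter commutes with \<open>c\<close> and can
  be dropped. So \<open>A\<close> acts transitively by conjugation on \<open>c A\<close>, a set of its own size, and
  therefore \<open>c\<close> commutes with no element of \<open>A\<close> except the identity. An element of \<open>A\<close> that
  normalises \<open>P\<close> and fixes \<open>d\<close> is a multiplication, commutes with \<open>c\<close> and is trivial. Hence the
  conjugates of \<open>P\<close> under the stabilizer of \<open>d\<close> have pairwise trivial intersection, and by counting
  they exhaust the complement of every point stabilizer. All point stabilizers then coincide and
  are trivial.
\<close>

lemma abelian_if_affine_coset_conjugate:
  assumes s: "s \<in> A" "s \<noteq> id" "s ^^ p = id"
    and c: "normalises c" and o: "d \<in> D" "c d = d" and cs: "c \<circ> s = s ^^ k \<circ> c"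
    and conj: "\<And>a. a \<in> A \<Longrightarrow> \<exists>n. normalises n \<and> n \<circ> c = c \<circ> a \<circ> n"
  shows "\<forall>a\<in>A. \<forall>b\<in>A. a \<circ> b = b \<circ> a"
proof -
  note sp = perm[OF s(1)]
  have cp: "c permutes D" using c by (simp add: normalises_def)
  have inner: "\<exists>b\<in>A. b \<circ> c = c \<circ> a \<circ> b" if a: "a \<in> A" for a
  proof -
    obtain n where n: "normalises n" "n \<circ> c = c \<circ> a \<circ> n" using conj[OF a] by blast
    have np: "n permutes D" using n by (simp add: normalises_def)
    \<comment> \<open>The Frattini argument: \<open>n\<close> carries \<open>P\<close> to a Sylow subgroup, which \<open>a1\<close> carries back.\<close>
    define t where "t = n \<circ> s \<circ> pinv n"
    have tn: "t \<circ> n = n \<circ> s" unfolding t_def using permutes_inverses[OF np] by (simp add: fun_eq_iff)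
    have "t ^^ m \<circ> n = n \<circ> s ^^ m" for m
    proof (induction m)
      case (Suc m)
      have "t ^^ Suc m \<circ> n = t \<circ> (t ^^ m \<circ> n)" by (simp add: o_assoc)
    also have "\<dots> = (t \<circ> n) \<circ> s ^^ m" by (simp only: Suc o_assoc)
    also have "\<dots> = n \<circ> s ^^ Suc m" by (simp only: tn comp_assoc funpow.simps)
    finally show ?case .
    qed simp
    then have "t ^^ p \<circ> n = id \<circ> n" using s by simp
    then have tp: "t ^^ p = id" using permutes_surj[OF np] by (metis surj_fun_eq)
    have "t \<in> A" unfolding t_def using normalises_conj n s by simp
    then obtain a1 j where a1: "a1 \<in> A" "t \<circ> a1 = a1 \<circ> s ^^ j"
      using order_p_conjugate[OF s _ tp] by blast
    note a1p = permutes_inv_o[OF perm[OF a1(1)]]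
    define n' where "n' = pinv a1 \<circ> n"
    have a1n: "n = a1 \<circ> n'" using a1p by (simp add: n'_def o_assoc)
    have n'p: "n' permutes D"
      unfolding n'_def using np a1 inv_mem perm by (simp add: permutes_compose)
    have "a1 \<circ> (n' \<circ> s) = a1 \<circ> (s ^^ j \<circ> n')"
    proof -
      have "a1 \<circ> (n' \<circ> s) = t \<circ> n" using a1n tn by (simp add: o_assoc)
      also have "\<dots> = a1 \<circ> s ^^ j \<circ> n'" using a1n a1(2) by (simp add: o_assoc)
      finally show ?thesis by (simp add: o_assoc)
    qed
    then have n's: "n' \<circ> s = s ^^ j \<circ> n'" by (simp only: cancel_left[OF a1(1)])
    have "n' d \<in> D" using n'p o permutes_in_image by metis
    then obtain i where i: "i < p" "(s ^^ i) d = n' d" using order_p_transitive[OF sp s(2,3) o(1)] by metis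
    define q where "q = s ^^ (p - i) \<circ> n'"
    have qd: "q d = d" using order_p_pow_compl(2)[OF s(3), of i] i
      unfolding q_def by (metis comp_apply id_apply less_imp_le)
    have qs: "q \<circ> s = s ^^ j \<circ> q"
      unfolding q_def using n's by (metis comp_assoc funpow_add add.commute)
    have qp: "q permutes D"
      unfolding q_def using n'p perm[OF funpow_mem[OF s(1)]] by (simp add: permutes_compose)
    have n'q: "n' = s ^^ i \<circ> q"
      unfolding q_def using order_p_pow_compl(1)[OF s(3), of i] i by (simp add: o_assoc)
    define a2 where "a2 = a1 \<circ> s ^^ i"
    have a2: "a2 \<in> A" unfolding a2_def using a1 s by (simp add: comp_mem funpow_mem)
    have nq: "n = a2 \<circ> q" by (simp add: a2_def a1n n'q o_assoc)
    have qc: "q \<circ> c = c \<circ> q" using affine_commute[OF sp s(2,3) o(1) qp qd qs cp o(2) cs] .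
    have "(a2 \<circ> c) \<circ> q = (c \<circ> a \<circ> a2) \<circ> q"
      using n(2) nq qc by (metis comp_assoc)
    then have "a2 \<circ> c = c \<circ> a \<circ> a2" using permutes_surj[OF qp] by (metis surj_fun_eq)
    then show ?thesis using a2 by blast
  qed
  \<comment> \<open>By \<open>inner\<close> this twisted commutator map is onto, hence one-to-one.\<close>
  define F where "F b = pinv c \<circ> (b \<circ> c \<circ> pinv b)" for b
  have FA: "F b \<in> A" if "b \<in> A" for b
  proof -
    have "F b = (pinv c \<circ> b \<circ> c) \<circ> pinv b" by (simp add: F_def o_assoc)
    then show ?thesis using normalises_conj_inv[OF c that] that comp_mem inv_mem by simp
  qed
  have "A \<subseteq> F ` A"
  proof
    fix a assume "a \<in> A"
    then obtain b where b: "b \<in> A" "b \<circ> c = c \<circ> a \<circ> b" using inner by blast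
    have "F b = pinv c \<circ> c \<circ> a \<circ> (b \<circ> pinv b)" unfolding F_def b by (simp add: o_assoc)
    then have "F b = a" using permutes_inv_o[OF cp] permutes_inv_o[OF perm[OF b(1)]] by simp
    then show "a \<in> F ` A" using b by blast
  qed
  then have "F ` A = A" using FA by auto
  then have Finj: "inj_on F A" using finite_A by (simp add: eq_card_imp_inj_on)
  have cent: "b = id" if b: "b \<in> A" "b \<circ> c = c \<circ> b" for b
  proof -
    have "F b = pinv c \<circ> c \<circ> (b \<circ> pinv b)" unfolding F_def b by (simp add: o_assoc)
    also have "\<dots> = F id" using permutes_inv_o[OF cp] permutes_inv_o[OF perm[OF b(1)]]
      by (simp add: F_def)
    finally show ?thesis using Finj b(1) id_mem by (simp add: inj_onD)
  qed
  \<comment> \<open>Enumerates the nontrivial elements of the conjugates of \<open>P\<close> without repetition.\<close>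
  define \<Phi> where "\<Phi> = (\<lambda>(a :: 'a \<Rightarrow> 'a, i::nat). a \<circ> s ^^ i \<circ> pinv a)"
  have \<Phi>inj: "inj_on \<Phi> (stab d \<times> {1..<p})"
  proof (rule inj_onI, clarify)
    fix a i b j assume h: "a \<in> stab d" "b \<in> stab d" "i \<in> {1..<p}" "j \<in> {1..<p}" "\<Phi> (a, i) = \<Phi> (b, j)"
    have A: "a \<in> A" "b \<in> A" using h by (auto simp: stab_def)
    note pa = permutes_inv_o[OF perm[OF A(1)]] and pb = permutes_inv_o[OF perm[OF A(2)]]
    define g where "g = pinv b \<circ> a"
    have gA: "g \<in> A" unfolding g_def using A comp_mem inv_mem by simp
    have "pinv b d = d" using h(2) permutes_inverses(2)[OF perm[OF A(2)]] unfolding stab_def by (metis (mono_tags, lifting) mem_Collect_eq)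
    then have gd: "g d = d" using h(1) unfolding g_def stab_def by simp
    have e: "a \<circ> s ^^ i \<circ> pinv a = b \<circ> s ^^ j \<circ> pinv b" using h(5) by (simp add: \<Phi>_def)
    have "g \<circ> s ^^ i = pinv b \<circ> (a \<circ> s ^^ i \<circ> pinv a) \<circ> a"
      using pa by (simp add: g_def comp_assoc)
    also have "\<dots> = s ^^ j \<circ> g" unfolding e using pb by (simp add: g_def o_assoc)
    finally have gs: "g \<circ> s ^^ i = s ^^ j \<circ> g" .
    have gsm: "g \<circ> s ^^ (i * m) = s ^^ (j * m) \<circ> g" for m
    proof (induction m)
      case (Suc m)
      have "g \<circ> s ^^ (i * Suc m) = (g \<circ> s ^^ i) \<circ> s ^^ (i * m)"
        by (simp only: funpow_add o_assoc mult_Suc_right)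
      also have "\<dots> = s ^^ j \<circ> (g \<circ> s ^^ (i * m))" by (simp only: gs comp_assoc)
      also have "\<dots> = s ^^ (j * Suc m) \<circ> g" by (simp only: Suc funpow_add o_assoc mult_Suc_right)
      finally show ?case .
    qed simp
    have "\<not> p dvd i" using h(3) by (auto dest: dvd_imp_le)
    then have "coprime i p" using prime_p by (metis coprime_commute prime_imp_coprime)
    \<comment> \<open>From \<open>s\<^sup>i\<close> back to \<open>s\<close>: \<open>x\<close> is an inverse of \<open>i\<close> modulo \<open>p\<close>.\<close>
    then obtain x y where xy: "i * x = p * y + 1"
      using h(3) coprime_bezout_strong[of i p] prime_p by (metis prime_nat_iff less_irrefl)
    have "s ^^ (i * x) = s"
      using order_p_pow_dvd[OF s(3), of "p * y"] by (simp add: xy)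
    then have "g \<circ> s = s ^^ (j * x) \<circ> g" using gsm[of x] by simp
    then have "g \<circ> c = c \<circ> g"
      using affine_commute[OF sp s(2,3) o(1) perm[OF gA] gd _ cp o(2) cs] by blast
    then have g1: "g = id" using cent gA by simp
    then have ab: "a = b" using pb unfolding g_def by (metis comp_assoc comp_id id_comp)
    have "(s ^^ i) d = (s ^^ j) d" using gs g1 by simp
    then have "i = j" using order_p_orbit[OF sp s(2,3) o(1)] h(3,4)
      by (auto simp: bij_betw_def dest: inj_onD)
    with ab show "a = b \<and> i = j" by simp
  qed
  have moved: "\<Phi> ` (stab d \<times> {1..<p}) = A - stab e" if e: "e \<in> D" for e
  proof (rule card_subset_eq)
    show "finite (A - stab e)" using finite_A by simp
    show "\<Phi> ` (stab d \<times> {1..<p}) \<subseteq> A - stab e"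
    proof clarify
      fix a i assume h: "a \<in> stab d" "i \<in> {1..<p}"
      then have aA: "a \<in> A" by (simp add: stab_def)
      note pa = permutes_inverses[OF perm[OF aA]]
      have "\<Phi> (a, i) \<in> A"
        unfolding \<Phi>_def using aA s by (auto intro!: comp_mem funpow_mem inv_mem)
      moreover have "\<Phi> (a, i) e \<noteq> e"
      proof
        assume "\<Phi> (a, i) e = e"
        then have "(s ^^ i) (pinv a e) = pinv a e" unfolding \<Phi>_def using pa by (metis (mono_tags, lifting) case_prod_conv comp_apply)
        moreover have "pinv a e \<in> D" using e permutes_in_image[OF permutes_inv[OF perm[OF aA]]] by simp
        ultimately have "p dvd i" using order_p_semiregular[OF sp s(2,3)] by blast
        then show False using h by (auto dest: dvd_imp_le)
      qed
      ultimately show "\<Phi> (a, i) \<in> A - stab e" by (simp add: stab_def)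
    qed
    have eq: "card (stab e) = card (stab d)"
      using card_stab[OF e] card_stab[OF o(1)] p_pos by simp
    have "card (A - stab e) = card A - card (stab e)"
      using finite_A by (intro card_Diff_subset) (auto simp: stab_def)
    also have "\<dots> = card (stab d) * (p - 1)"
      using card_stab[OF o(1)] eq by (simp add: algebra_simps)
    finally show "card (\<Phi> ` (stab d \<times> {1..<p})) = card (A - stab e)"
      using card_image[OF \<Phi>inj] by (simp add: card_cartesian_product)
  qed
  have "a = id" if a: "a \<in> stab d" for a
  proof
    fix x show "a x = id x"
    proof (cases "x \<in> D")
      case True
      have "A - stab x = A - stab d" using moved[OF True] moved[OF o(1)] by simp
      then show ?thesis using a by (auto simp: stab_def)
    next
      case False
      then show ?thesis using a permutes_not_in[OF perm] by (simp add: stab_def)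
    qed
  qed
  then have reg: "a = b" if "a \<in> A" "b \<in> A" "a d = b d" for a b
  proof -
    have "pinv b \<circ> a \<in> stab d"
      using that permutes_inverses(2)[OF perm[OF that(2)]] comp_mem inv_mem by (simp add: stab_def)
    then have "pinv b \<circ> a = id" using \<open>\<And>a. a \<in> stab d \<Longrightarrow> a = id\<close> by blast
    then show ?thesis using permutes_inv_o(1)[OF perm[OF that(2)]] by (metis comp_assoc comp_id id_comp)
  qed
  have "\<exists>k. a = s ^^ k" if a: "a \<in> A" for a
  proof -
    have "a d \<in> D" using a o perm permutes_in_image by metis
    then obtain k where "(s ^^ k) d = a d" using order_p_transitive[OF sp s(2,3) o(1)] by metis
    then show ?thesis using reg[OF a funpow_mem[OF s(1)]] by metis
  qed
  then show ?thesis by (metis add.commute funpow_add)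
qed

text \<open>
  Some element of \<open>c A\<close> has a fixed point because \<open>A\<close> is transitive, hence all of them do, being
  conjugate. Among them is one that normalises a given Sylow subgroup, because Sylow subgroups are
  conjugate in \<open>A\<close>. The assumptions on \<open>c\<close> pass to every element of \<open>c A\<close>.
\<close>

theorem abelian_if_coset_conjugate:
  assumes c: "normalises c"
    and conj: "\<And>a. a \<in> A \<Longrightarrow> \<exists>n. normalises n \<and> n \<circ> c = c \<circ> a \<circ> n"
  shows "\<forall>a\<in>A. \<forall>b\<in>A. a \<circ> b = b \<circ> a"
proof -
  have cp: "c permutes D" using c by (simp add: normalises_def)
  obtain d where d: "d \<in> D" using card_D p_pos by fastforce
  have "p dvd card A" using card_stab[OF d] by simp
  then obtain s where s: "s \<in> A" "s \<noteq> id" "s ^^ p = id" using order_prime_exists[OF prime_p] by blast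
  have fixed: "\<exists>e\<in>D. c (a e) = e" if a: "a \<in> A" for a
  proof -
    have "pinv c d \<in> D" using d permutes_in_image[OF permutes_inv[OF cp]] by simp
    then obtain a0 where a0: "a0 \<in> A" "a0 d = pinv c d" using trans[OF d] by metis
    obtain n0 where n0: "normalises n0" "n0 \<circ> c = c \<circ> a0 \<circ> n0" using conj[OF a0(1)] by blast
    have n0p: "n0 permutes D" using n0 by (simp add: normalises_def)
    define e where "e = pinv n0 d"
    have e: "e \<in> D" unfolding e_def using d permutes_in_image[OF permutes_inv[OF n0p]] by simp
    have "n0 (c e) = c (a0 (n0 e))" using n0(2) by (metis comp_apply)
    also have "\<dots> = n0 e" unfolding e_def
      using permutes_inverses[OF n0p] permutes_inverses[OF cp] a0 by simp
    finally have ce: "c e = e" using permutes_inj[OF n0p] by (auto dest: injD)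
    obtain n where n: "normalises n" "n \<circ> c = c \<circ> a \<circ> n" using conj[OF a] by blast
    have "c (a (n e)) = n e" using n(2) ce by (metis comp_apply)
    moreover have "n e \<in> D" using n(1) e permutes_in_image unfolding normalises_def by metis
    ultimately show ?thesis by blast
  qed
  define t where "t = c \<circ> s \<circ> pinv c"
  have tc: "t \<circ> c = c \<circ> s" unfolding t_def using permutes_inverses[OF cp] by (simp add: fun_eq_iff)
  have "t ^^ m \<circ> c = c \<circ> s ^^ m" for m
  proof (induction m)
    case (Suc m)
    have "t ^^ Suc m \<circ> c = t \<circ> (t ^^ m \<circ> c)" by (simp add: o_assoc)
    also have "\<dots> = (t \<circ> c) \<circ> s ^^ m" by (simp only: Suc o_assoc)
    also have "\<dots> = c \<circ> s ^^ Suc m" by (simp only: tc comp_assoc funpow.simps)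
    finally show ?case .
  qed simp
  then have "t ^^ p \<circ> c = id \<circ> c" using s by simp
  then have tp: "t ^^ p = id" using permutes_surj[OF cp] by (metis surj_fun_eq)
  have "t \<in> A" unfolding t_def using normalises_conj c s by simp
  then obtain a1 j where a1: "a1 \<in> A" "t \<circ> a1 = a1 \<circ> s ^^ j"
    using order_p_conjugate[OF s _ tp] by blast
  note a1p = permutes_inv_o[OF perm[OF a1(1)]]
  define c' where "c' = pinv a1 \<circ> c"
  have c'c: "c = a1 \<circ> c'" using a1p by (simp add: c'_def o_assoc)
  define b where "b = pinv c \<circ> pinv a1 \<circ> c"
  have b: "b \<in> A" unfolding b_def using normalises_conj_inv[OF c inv_mem[OF a1(1)]] .
  have c'b: "c' = c \<circ> b" unfolding c'_def b_def using permutes_inv_o[OF cp] by (simp add: o_assoc)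
  have bp: "b permutes D" using perm[OF b] .
  have "a1 \<circ> (c' \<circ> s) = a1 \<circ> (s ^^ j \<circ> c')"
  proof -
    have "a1 \<circ> (c' \<circ> s) = t \<circ> c" using c'c tc by (simp add: o_assoc)
    also have "\<dots> = a1 \<circ> s ^^ j \<circ> c'" using c'c a1(2) by (simp add: o_assoc)
    finally show ?thesis by (simp add: o_assoc)
  qed
  then have c's: "c' \<circ> s = s ^^ j \<circ> c'" by (simp only: cancel_left[OF a1(1)])
  obtain e where e: "e \<in> D" "c' e = e" using fixed[OF b] c'b by auto
  have c'n: "normalises c'"
    unfolding normalises_def
  proof (intro conjI ballI)
    show "c' permutes D" unfolding c'b using cp bp by (simp add: permutes_compose)
    fix a assume a: "a \<in> A"
    have "b \<circ> a \<circ> pinv b \<in> A" using a b by (simp add: comp_mem inv_mem)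
    then obtain a' where a': "a' \<in> A" "c \<circ> (b \<circ> a \<circ> pinv b) = a' \<circ> c"
      using c unfolding normalises_def by blast
    have "c' \<circ> a = c \<circ> (b \<circ> a \<circ> pinv b) \<circ> b"
      unfolding c'b using permutes_inverses[OF bp] by (simp add: fun_eq_iff)
    then show "\<exists>a'\<in>A. c' \<circ> a = a' \<circ> c'" using a' unfolding c'b by (metis comp_assoc)
  qed
  have "\<exists>n. normalises n \<and> n \<circ> c' = c' \<circ> a \<circ> n" if a: "a \<in> A" for a
  proof -
    obtain n1 where n1: "normalises n1" "n1 \<circ> c = c \<circ> b \<circ> n1" using conj[OF b] by blast
    obtain n2 where n2: "normalises n2" "n2 \<circ> c = c \<circ> (b \<circ> a) \<circ> n2"
      using conj[OF comp_mem[OF b a]] by blast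
    have p1: "n1 permutes D" and p2: "n2 permutes D" using n1 n2 by (auto simp: normalises_def)
    have "normalises (n2 \<circ> pinv n1)"
      unfolding normalises_def
    proof (intro conjI ballI)
      show "(n2 \<circ> pinv n1) permutes D" using p1 p2 by (simp add: permutes_compose permutes_inv)
      fix x assume x: "x \<in> A"
      obtain y where y: "y \<in> A" "n2 \<circ> (pinv n1 \<circ> x \<circ> n1) = y \<circ> n2"
        using n2(1) normalises_conj_inv[OF n1(1) x] unfolding normalises_def by blast
      have "n2 \<circ> pinv n1 \<circ> x = n2 \<circ> (pinv n1 \<circ> x \<circ> n1) \<circ> pinv n1"
        using permutes_inverses[OF p1] by (simp add: fun_eq_iff)
      also have "\<dots> = y \<circ> (n2 \<circ> pinv n1)" unfolding y(2) by (simp add: o_assoc)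
      finally show "\<exists>y\<in>A. n2 \<circ> pinv n1 \<circ> x = y \<circ> (n2 \<circ> pinv n1)" using y by blast
    qed
    moreover have "(n2 \<circ> pinv n1) \<circ> c' = c' \<circ> a \<circ> (n2 \<circ> pinv n1)"
    proof -
      have "pinv n1 \<circ> c' = pinv n1 \<circ> (c \<circ> b \<circ> n1) \<circ> pinv n1"
        unfolding c'b using permutes_inverses[OF p1] by (simp add: fun_eq_iff)
      also have "\<dots> = c \<circ> pinv n1"
        unfolding n1(2)[symmetric] using permutes_inverses[OF p1] by (simp add: fun_eq_iff)
      finally have "n2 \<circ> (pinv n1 \<circ> c') = n2 \<circ> c \<circ> pinv n1" by (simp add: o_assoc)
      then show ?thesis unfolding n2(2) unfolding c'b by (simp add: o_assoc)
    qed
    ultimately show ?thesis by blast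
  qed
  then show ?thesis
    using abelian_if_affine_coset_conjugate[OF s c'n e c's] by blast
qed

end

section \<open>Rooted trees and their automorphisms\<close>

locale rooted =
  fixes T :: "'v rtree"
  assumes rooted: "rooted_tree T"
begin

lemma root_mem: "root T \<in> verts T" and parent_root: "parent T (root T) = root T"
  and parent_mem: "v \<in> verts T \<Longrightarrow> parent T v \<in> verts T"
  using rooted by (auto simp: rooted_tree_def)

lemma ancestor_mem: "v \<in> verts T \<Longrightarrow> (parent T ^^ n) v \<in> verts T"
  by (induction n) (auto simp: parent_mem)

lemma ancestor_depth: "v \<in> verts T \<Longrightarrow> (parent T ^^ depth T v) v = root T"
  using rooted unfolding rooted_tree_def depth_def by (metis (mono_tags, lifting) LeastI_ex)

lemma depth_le: "(parent T ^^ n) v = root T \<Longrightarrow> depth T v \<le> n"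
  unfolding depth_def by (rule Least_le)

lemma depth_root: "depth T (root T) = 0"
  using depth_le[of 0] by simp

lemma depth_0_iff: "v \<in> verts T \<Longrightarrow> depth T v = 0 \<longleftrightarrow> v = root T"
  using ancestor_depth[of v] depth_root by auto

lemma depth_parent:
  assumes "v \<in> verts T" "v \<noteq> root T"
  shows "depth T v = Suc (depth T (parent T v))"
proof -
  obtain n where n: "depth T v = Suc n" using depth_0_iff assms by (cases "depth T v") auto
  then have "(parent T ^^ n) (parent T v) = root T"
    using ancestor_depth[OF assms(1)] by (simp add: funpow_swap1)
  then have "depth T (parent T v) \<le> n" by (rule depth_le)
  moreover have "(parent T ^^ Suc (depth T (parent T v))) v = root T"
    using ancestor_depth[OF parent_mem[OF assms(1)]] by (simp add: funpow_swap1)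
  then have "depth T v \<le> Suc (depth T (parent T v))" by (rule depth_le)
  ultimately show ?thesis using n by simp
qed

lemma depth_parent': "v \<in> verts T \<Longrightarrow> depth T (parent T v) = depth T v - 1"
  using depth_parent[of v] depth_root parent_root by (cases "v = root T") auto

lemma depth_ancestor: "v \<in> verts T \<Longrightarrow> depth T ((parent T ^^ n) v) = depth T v - n"
  by (induction n) (auto simp: depth_parent' ancestor_mem)

text \<open>
  As the root is its own parent, the number of steps from \<open>u\<close> up to \<open>v\<close> need not be unique; it
  can always be taken to be the difference of the depths.
\<close>

lemma subtree_iff:
  "u \<in> subtree T v \<longleftrightarrow>
     u \<in> verts T \<and> v \<in> verts T \<and> depth T v \<le> depth T u \<and> (parent T ^^ (depth T u - depth T v)) u = v"
  (is "?L \<longleftrightarrow> ?R")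
proof
  assume ?L
  then obtain n where n: "u \<in> verts T" "(parent T ^^ n) u = v" by (auto simp: subtree_def)
  then have d: "depth T v = depth T u - n" "v \<in> verts T"
    using depth_ancestor ancestor_mem by blast+
  show ?R
  proof (cases "n \<le> depth T u")
    case True
    then show ?thesis using n d by auto
  next
    case False
    then have "v = root T" using d depth_0_iff by auto
    then show ?thesis using n d ancestor_depth False by (auto simp: depth_root root_mem)
  qed
qed (auto simp: subtree_def)

lemma subtreeD:
  assumes "u \<in> subtree T v"
  shows "u \<in> verts T" "v \<in> verts T" "depth T v \<le> depth T u"
  using assms by (auto simp: subtree_iff)

lemma subtree_refl: "v \<in> verts T \<Longrightarrow> v \<in> subtree T v"
  by (simp add: subtree_iff)

lemma subtree_trans: "x \<in> subtree T u \<Longrightarrow> u \<in> subtree T v \<Longrightarrow> x \<in> subtree T v"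
  unfolding subtree_def by clarsimp (metis comp_apply funpow_add)

lemma subtree_unique:
  "u \<in> subtree T v \<Longrightarrow> u \<in> subtree T w \<Longrightarrow> depth T v = depth T w \<Longrightarrow> v = w"
  by (auto simp: subtree_iff)

lemma subtree_parent: "v \<in> verts T \<Longrightarrow> v \<in> subtree T (parent T v)"
  unfolding subtree_def by (auto intro!: exI[of _ 1])

lemma subtree_root: "subtree T (root T) = verts T"
  using rooted by (auto simp: subtree_def rooted_tree_def)

lemma childrenD:
  assumes "u \<in> children T v"
  shows "u \<in> verts T" "v \<in> verts T" "parent T u = v" "depth T u = Suc (depth T v)"
  using assms depth_parent[of u] parent_mem[of u] by (auto simp: children_def)

lemma children_iff_depth:
  "u \<in> children T v \<longleftrightarrow> u \<in> verts T \<and> parent T u = v \<and> 0 < depth T u"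
  using depth_0_iff[of u] by (auto simp: children_def)

context
  fixes f assumes aut: "tree_automorphism T f"
begin

lemma aut_mem: "v \<in> verts T \<Longrightarrow> f v \<in> verts T"
  and aut_inj: "u \<in> verts T \<Longrightarrow> v \<in> verts T \<Longrightarrow> f u = f v \<longleftrightarrow> u = v"
  and aut_root: "f (root T) = root T"
  and aut_parent: "v \<in> verts T \<Longrightarrow> parent T (f v) = f (parent T v)"
  using aut by (auto simp: tree_automorphism_def bij_betw_def dest: inj_onD)

lemma aut_surj: "w \<in> verts T \<Longrightarrow> \<exists>v\<in>verts T. f v = w"
  using aut unfolding tree_automorphism_def bij_betw_def by (metis imageE)

lemma aut_ancestor: "v \<in> verts T \<Longrightarrow> (parent T ^^ n) (f v) = f ((parent T ^^ n) v)"
  by (induction n) (auto simp: aut_parent ancestor_mem)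

lemma aut_depth: "v \<in> verts T \<Longrightarrow> depth T (f v) = depth T v"
  unfolding depth_def using aut_ancestor aut_inj aut_root ancestor_mem root_mem by metis

lemma aut_subtree: "u \<in> verts T \<Longrightarrow> v \<in> verts T \<Longrightarrow> f u \<in> subtree T (f v) \<longleftrightarrow> u \<in> subtree T v"
  by (auto simp: subtree_iff aut_mem aut_depth aut_ancestor aut_inj ancestor_mem)

lemma aut_children: "u \<in> verts T \<Longrightarrow> v \<in> verts T \<Longrightarrow> f u \<in> children T (f v) \<longleftrightarrow> u \<in> children T v"
  by (auto simp: children_iff_depth aut_mem aut_depth aut_parent aut_inj parent_mem)

lemma aut_level: "v \<in> level T n \<Longrightarrow> f v \<in> level T n"
  by (simp add: level_def aut_mem aut_depth)

end

lemma aut_id: "tree_automorphism T id"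
  by (simp add: tree_automorphism_def)

lemma aut_comp:
  assumes f: "tree_automorphism T f" and g: "tree_automorphism T g"
  shows "tree_automorphism T (f \<circ> g)"
  unfolding tree_automorphism_def
proof (intro conjI ballI)
  show "bij_betw (f \<circ> g) (verts T) (verts T)"
    using f g by (auto simp: tree_automorphism_def intro: bij_betw_trans)
qed (auto simp: f g aut_root aut_parent aut_mem)

lemma aut_funpow: "tree_automorphism T f \<Longrightarrow> tree_automorphism T (f ^^ n)"
  by (induction n) (auto simp: aut_id[unfolded id_def] aut_comp[unfolded comp_def] aut_id aut_comp)

end

locale leafless = rooted +
  assumes has_child: "v \<in> verts T \<Longrightarrow> children T v \<noteq> {}"
begin

lemma descendant_exists:
  assumes "v \<in> verts T" "depth T v \<le> n"
  shows "\<exists>u\<in>subtree T v. u \<in> level T n"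
  using assms(2)
proof (induction n rule: dec_induct)
  case base
  then show ?case using assms by (auto simp: level_def subtree_refl)
next
  case (step n)
  then obtain u where u: "u \<in> subtree T v" "u \<in> level T n" by blast
  then obtain x where x: "x \<in> children T u" using has_child by (auto simp: level_def)
  then have "x \<in> level T (Suc n)" using childrenD[OF x] u by (simp add: level_def)
  moreover have "x \<in> subtree T u" using childrenD[OF x] subtree_parent by metis
  ultimately show ?case using u subtree_trans by blast
qed

end

section \<open>Rigid stabilizers\<close>

text \<open>
  The rigid stabilizer of \<open>v\<close>.
\<close>

definition rist ::
  "'v rtree \<Rightarrow> ('g, 'm) monoid_scheme \<Rightarrow> ('g \<Rightarrow> 'v \<Rightarrow> 'v) \<Rightarrow> 'v \<Rightarrow> 'g set" where
  "rist T G \<phi> v = {g \<in> carrier G. \<forall>u\<in>verts T - subtree T v. \<phi> g u = u}"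

locale tree_action = leafless T + group G
  for T :: "'v rtree" and G :: "('g, 'm) monoid_scheme" (structure) +
  fixes \<phi> :: "'g \<Rightarrow> 'v \<Rightarrow> 'v"
  assumes faithful: "faithful_tree_action T G \<phi>"
begin

sublocale action: group_action G "verts T" \<phi>
  using faithful by (simp add: faithful_tree_action_def faithful_action_def)

lemma act_aut: "g \<in> carrier G \<Longrightarrow> tree_automorphism T (\<phi> g)"
  using faithful by (simp add: faithful_tree_action_def)

lemma act_mult:
  "g \<in> carrier G \<Longrightarrow> h \<in> carrier G \<Longrightarrow> v \<in> verts T \<Longrightarrow> \<phi> (g \<otimes> h) v = \<phi> g (\<phi> h v)"
  by (rule action.composition_rule)

lemma act_one: "v \<in> verts T \<Longrightarrow> \<phi> \<one> v = v"
  using action.id_eq_one by (metis restrict_apply')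

lemma act_mem: "g \<in> carrier G \<Longrightarrow> v \<in> verts T \<Longrightarrow> \<phi> g v \<in> verts T"
  using aut_mem[OF act_aut] .

lemma act_inv:
  assumes "g \<in> carrier G" "v \<in> verts T"
  shows "\<phi> (inv g) (\<phi> g v) = v" "\<phi> g (\<phi> (inv g) v) = v"
  using assms act_mult[of "inv g" g v] act_mult[of g "inv g" v] by (simp_all add: act_one)

lemma act_eqI:
  assumes "g \<in> carrier G" "h \<in> carrier G" "\<And>v. v \<in> verts T \<Longrightarrow> \<phi> g v = \<phi> h v"
  shows "g = h"
proof -
  have "\<phi> g = \<phi> h"
    using action.bij_prop0[OF assms(1)] action.bij_prop0[OF assms(2)] assms(3)
    by (intro extensionalityI[of _ "verts T"]) (auto dest: Bij_imp_extensional)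
  then show ?thesis
    using faithful assms(1,2)
    by (auto simp: faithful_tree_action_def faithful_action_def faithful_action_axioms_def dest: inj_onD)
qed

lemma moves_vertex: "g \<in> carrier G \<Longrightarrow> g \<noteq> \<one> \<Longrightarrow> \<exists>v\<in>verts T. \<phi> g v \<noteq> v"
  using act_eqI[of g \<one>] act_one by auto

lemma fixes_ancestor:
  assumes "g \<in> carrier G" "u \<in> subtree T v" "\<phi> g u = u"
  shows "\<phi> g v = v"
proof -
  note u = subtreeD[OF assms(2)]
  have "\<phi> g u \<in> subtree T (\<phi> g v)" using aut_subtree[OF act_aut] assms u by blast
  then show ?thesis
    using assms u aut_depth[OF act_aut] subtree_unique by metis
qed

lemma ristD: "g \<in> rist T G \<phi> v \<Longrightarrow> g \<in> carrier G"
  "g \<in> rist T G \<phi> v \<Longrightarrow> u \<in> verts T \<Longrightarrow> u \<notin> subtree T v \<Longrightarrow> \<phi> g u = u"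
  by (auto simp: rist_def)

lemma rist_mono: "u \<in> subtree T v \<Longrightarrow> rist T G \<phi> u \<subseteq> rist T G \<phi> v"
  using subtree_trans by (auto simp: rist_def)

lemma rist_subgroup: "v \<in> verts T \<Longrightarrow> subgroup (rist T G \<phi> v) G"
proof (rule subgroupI)
  show "inv g \<in> rist T G \<phi> v" if "g \<in> rist T G \<phi> v" for g
    using that act_inv unfolding rist_def by (auto, metis DiffI)
qed (auto simp: rist_def act_mult act_one intro: exI[of _ \<one>])

lemma rist_mult: "v \<in> verts T \<Longrightarrow> a \<in> rist T G \<phi> v \<Longrightarrow> b \<in> rist T G \<phi> v \<Longrightarrow> a \<otimes> b \<in> rist T G \<phi> v"
  and rist_inv: "v \<in> verts T \<Longrightarrow> a \<in> rist T G \<phi> v \<Longrightarrow> inv a \<in> rist T G \<phi> v"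
  using subgroup.m_closed[OF rist_subgroup] subgroup.m_inv_closed[OF rist_subgroup] by blast+

lemma rist_conj:
  assumes "g \<in> rist T G \<phi> v" "h \<in> carrier G" "v \<in> verts T"
  shows "h \<otimes> g \<otimes> inv h \<in> rist T G \<phi> (\<phi> h v)"
proof -
  have g: "g \<in> carrier G" using assms ristD by blast
  have "\<phi> (h \<otimes> g \<otimes> inv h) u = u" if u: "u \<in> verts T" "u \<notin> subtree T (\<phi> h v)" for u
  proof -
    have "\<phi> (inv h) u \<notin> subtree T v"
      using u assms aut_subtree[OF act_aut[OF assms(2)], of "\<phi> (inv h) u" v] act_inv act_mem
      by (metis inv_closed)
    then have "\<phi> g (\<phi> (inv h) u) = \<phi> (inv h) u"
      using ristD(2)[OF assms(1)] act_mem u assms(2) by simp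
    then show ?thesis using g assms u by (simp add: act_mult act_mem act_inv)
  qed
  then show ?thesis using g assms by (simp add: rist_def)
qed

lemma rist_fixes:
  assumes "g \<in> rist T G \<phi> v" "v \<in> verts T"
  shows "\<phi> g v = v"
proof (cases "\<phi> g v \<in> subtree T v")
  case True
  then show ?thesis
    using assms ristD aut_depth[OF act_aut] act_mem subtree_unique subtree_refl by metis
next
  case False
  have g: "g \<in> carrier G" using assms ristD by blast
  then have "\<phi> g (\<phi> g v) = \<phi> g v" using False ristD(2)[OF assms(1)] act_mem assms by simp
  then show ?thesis using aut_inj[OF act_aut[OF g]] act_mem g assms by simp
qed

lemma rist_preserves:
  assumes "g \<in> rist T G \<phi> v" "u \<in> subtree T v"
  shows "\<phi> g u \<in> subtree T v"
  using assms aut_subtree[OF act_aut, of g u v] rist_fixes[OF assms(1)] ristD(1) subtreeD by metis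

lemma rist_moves:
  assumes "g \<in> rist T G \<phi> v" "g \<noteq> \<one>"
  shows "\<exists>u\<in>subtree T v. \<phi> g u \<noteq> u"
  using moves_vertex[OF ristD(1)[OF assms(1)] assms(2)] ristD(2)[OF assms(1)] by blast

lemma rist_commute:
  assumes "a \<in> rist T G \<phi> v" "b \<in> rist T G \<phi> w" "depth T v = depth T w" "v \<noteq> w"
  shows "a \<otimes> b = b \<otimes> a"
proof (rule act_eqI)
  have ab: "a \<in> carrier G" "b \<in> carrier G" using assms ristD by blast+
  show "a \<otimes> b \<in> carrier G" "b \<otimes> a \<in> carrier G" using ab by auto
  fix x assume x: "x \<in> verts T"
  consider "x \<in> subtree T v" "x \<notin> subtree T w" | "x \<in> subtree T w" "x \<notin> subtree T v"
    | "x \<notin> subtree T v" "x \<notin> subtree T w" using subtree_unique assms by blast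
  then show "\<phi> (a \<otimes> b) x = \<phi> (b \<otimes> a) x"
  proof cases
    case 1
    have "\<phi> a x \<in> subtree T v" using rist_preserves assms 1 by blast
    then have "\<phi> a x \<notin> subtree T w" using subtree_unique assms by blast
    then show ?thesis using 1 x ab ristD(2)[OF assms(2)] by (simp add: act_mult act_mem)
  next
    case 2
    have "\<phi> b x \<in> subtree T w" using rist_preserves assms 2 by blast
    then have "\<phi> b x \<notin> subtree T v" using subtree_unique assms by blast
    then show ?thesis using 2 x ab ristD(2)[OF assms(1)] by (simp add: act_mult act_mem)
  next
    case 3
    then show ?thesis using x ab ristD(2)[OF assms(1)] ristD(2)[OF assms(2)] by (simp add: act_mult)
  qed
qed

text \<open>
  The conjugate of \<open>g\<close> by \<open>b\<close> lives on the subtree at \<open>b u\<close>, which is disjoint from the subtree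
  at \<open>u\<close>. Such commutators are how a normal subgroup containing \<open>b\<close> is seen to contain elements
  with prescribed action on a subtree.
\<close>

lemma commutator_acts:
  assumes "b \<in> carrier G" "\<phi> b u \<noteq> u" "g \<in> rist T G \<phi> u" "x \<in> subtree T u"
  shows "\<phi> (g \<otimes> (b \<otimes> inv g \<otimes> inv b)) x = \<phi> g x"
proof -
  have u: "u \<in> verts T" "x \<in> verts T" using assms subtreeD by blast+
  have g: "g \<in> carrier G" using assms ristD by blast
  have "inv g \<in> rist T G \<phi> u" using assms(3) by (intro rist_inv u)
  then have r: "b \<otimes> inv g \<otimes> inv b \<in> rist T G \<phi> (\<phi> b u)" using rist_conj assms u by blast
  have "x \<notin> subtree T (\<phi> b u)"
    using subtree_unique assms aut_depth[OF act_aut[OF assms(1)] u(1)] by metis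
  then have "\<phi> (b \<otimes> inv g \<otimes> inv b) x = x" using ristD(2)[OF r] u by blast
  then show ?thesis using u g assms by (simp add: act_mult)
qed

lemma commutator_nontrivial:
  assumes "b \<in> carrier G" "\<phi> b u \<noteq> u" "g \<in> rist T G \<phi> u" "g \<noteq> \<one>"
  shows "g \<otimes> (b \<otimes> inv g \<otimes> inv b) \<noteq> \<one>"
proof -
  obtain x where "x \<in> subtree T u" "\<phi> g x \<noteq> x" using rist_moves assms by blast
  then have "\<phi> (g \<otimes> (b \<otimes> inv g \<otimes> inv b)) x \<noteq> x" "x \<in> verts T"
    using commutator_acts[OF assms(1-3)] subtreeD by auto
  then show ?thesis using act_one by auto
qed

lemma commutator_assoc:
  "g \<in> carrier G \<Longrightarrow> b \<in> carrier G \<Longrightarrow> g \<otimes> (b \<otimes> inv g \<otimes> inv b) = g \<otimes> b \<otimes> inv g \<otimes> inv b"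
  by (simp add: m_assoc)

lemma moves_descendant:
  assumes "b \<in> carrier G" "u \<in> subtree T w" "\<phi> b u \<noteq> u" "depth T u \<le> n"
  obtains x where "x \<in> subtree T w" "x \<in> level T n" "\<phi> b x \<noteq> x"
proof -
  obtain x where x: "x \<in> subtree T u" "x \<in> level T n"
    using descendant_exists subtreeD(1)[OF assms(2)] assms(4) by blast
  then show ?thesis using that fixes_ancestor assms subtree_trans by blast
qed

end

text \<open>
  The property of \<open>H\<^sub>n\<close> in the definition of saturation, with normality in place of invariance
  under all automorphisms: one subgroup has to be compared with two actions of \<open>G\<close>.
\<close>

definition saturating ::
  "'v rtree \<Rightarrow> ('g, 'm) monoid_scheme \<Rightarrow> ('g \<Rightarrow> 'v \<Rightarrow> 'v) \<Rightarrow> nat \<Rightarrow> 'g set \<Rightarrow> bool" where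
  "saturating T G \<phi> n H \<longleftrightarrow> H \<lhd> G \<and> (\<forall>h\<in>H. \<forall>v\<in>level T n. \<phi> h v = v) \<and>
     (\<forall>v\<in>level T n. level_transitive_on_subtree T \<phi> H v)"

locale weakly_branch_action = tree_action +
  assumes rist_nontrivial: "v \<in> verts T \<Longrightarrow> \<exists>g\<in>rist T G \<phi> v. g \<noteq> \<one>"
begin

lemma saturatingD:
  assumes "saturating T G \<phi> n H"
  shows "subgroup H G" "h \<in> H \<Longrightarrow> h \<in> carrier G"
    "h \<in> H \<Longrightarrow> g \<in> carrier G \<Longrightarrow> g \<otimes> h \<otimes> inv g \<in> H"
    "h \<in> H \<Longrightarrow> v \<in> level T n \<Longrightarrow> \<phi> h v = v"
    "v \<in> level T n \<Longrightarrow> x \<in> subtree T v \<Longrightarrow> y \<in> subtree T v \<Longrightarrow> depth T x = depth T y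
       \<Longrightarrow> \<exists>h\<in>H. \<phi> h x = y"
proof -
  have n: "H \<lhd> G" using assms by (simp add: saturating_def)
  show "subgroup H G" using n normal_imp_subgroup by blast
  then show "h \<in> H \<Longrightarrow> h \<in> carrier G" using subgroup.mem_carrier by metis
  show "h \<in> H \<Longrightarrow> g \<in> carrier G \<Longrightarrow> g \<otimes> h \<otimes> inv g \<in> H"
    using n by (simp add: normal.inv_op_closed2)
  show "h \<in> H \<Longrightarrow> v \<in> level T n \<Longrightarrow> \<phi> h v = v" using assms by (simp add: saturating_def)
  show "\<exists>h\<in>H. \<phi> h x = y"
    if v: "v \<in> level T n" and xy: "x \<in> subtree T v" "y \<in> subtree T v" "depth T x = depth T y"
  proof -
    have "transitive_on \<phi> H (level T (depth T x) \<inter> subtree T v)"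
      using assms v by (simp add: saturating_def level_transitive_on_subtree_def)
    moreover have "x \<in> level T (depth T x)" "y \<in> level T (depth T x)"
      using xy subtreeD(1) by (auto simp: level_def)
    ultimately show ?thesis using xy unfolding transitive_on_def by blast
  qed
qed

text \<open>
  A commutator of \<open>k\<close>, supported deep below \<open>u\<close>, with an element \<open>h\<close> of \<open>H\<close> that fixes \<open>u\<close> but
  moves the support of \<open>k\<close> lies in \<open>H\<close> and in the rigid stabilizer of \<open>u\<close>. Such an \<open>h\<close> exists by
  level-transitivity: it is made to agree at one vertex \<open>x\<close> below \<open>u\<close> with some \<open>g\<close> that is
  supported below \<open>u\<close> and moves \<open>x\<close>.
\<close>

lemma saturating_rist_nontrivial:
  assumes H: "saturating T G \<phi> n H" and v: "v \<in> level T n" and u: "u \<in> subtree T v"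
  shows "\<exists>k\<in>H \<inter> rist T G \<phi> u. k \<noteq> \<one>"
proof -
  have uV: "u \<in> verts T" using u subtreeD by blast
  obtain g where g: "g \<in> rist T G \<phi> u" "g \<noteq> \<one>" using rist_nontrivial uV by blast
  obtain x where x: "x \<in> subtree T u" "\<phi> g x \<noteq> x" using rist_moves g by blast
  have gx: "\<phi> g x \<in> subtree T u" using rist_preserves g x by blast
  have xV: "x \<in> verts T" using x subtreeD by blast
  have dep: "depth T x = depth T (\<phi> g x)"
    using aut_depth[OF act_aut[OF ristD(1)[OF g(1)]] xV] by simp
  obtain h where h: "h \<in> H" "\<phi> h x = \<phi> g x"
    using saturatingD(5)[OF H v subtree_trans[OF x(1) u] subtree_trans[OF gx u] dep] by blast
  have hG: "h \<in> carrier G" using h saturatingD(2)[OF H] by blast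
  have hu: "\<phi> h u = u"
  proof -
    have "\<phi> g x \<in> subtree T (\<phi> h u)" using aut_subtree[OF act_aut[OF hG] xV uV] x h by simp
    then show ?thesis using subtree_unique[OF _ gx] aut_depth[OF act_aut[OF hG] uV] by blast
  qed
  obtain k where k: "k \<in> rist T G \<phi> x" "k \<noteq> \<one>" using rist_nontrivial xV by blast
  have kG: "k \<in> carrier G" using k ristD by blast
  define c where "c = k \<otimes> (h \<otimes> inv k \<otimes> inv h)"
  have "c \<noteq> \<one>" unfolding c_def using commutator_nontrivial[OF hG _ k] h(2) x(2) by simp
  moreover have "c \<in> H"
    unfolding c_def commutator_assoc[OF kG hG]
    using subgroup.m_closed[OF saturatingD(1)[OF H] saturatingD(3)[OF H h(1) kG]]
      subgroup.m_inv_closed[OF saturatingD(1)[OF H] h(1)] by blast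
  moreover have "c \<in> rist T G \<phi> u"
  proof -
    have ku: "k \<in> rist T G \<phi> u" using rist_mono x k by blast
    then have ki: "inv k \<in> rist T G \<phi> u" by (intro rist_inv uV)
    then have "h \<otimes> inv k \<otimes> inv h \<in> rist T G \<phi> u" using rist_conj[OF ki hG uV] hu by simp
    then show ?thesis unfolding c_def using ku by (simp add: rist_mult uV)
  qed
  ultimately show ?thesis by blast
qed

lemma saturating_rist_nonabelian:
  assumes H: "saturating T G \<phi> n H" and v: "v \<in> level T n" and u: "u \<in> subtree T v"
  shows "\<exists>g\<in>H \<inter> rist T G \<phi> u. \<exists>k\<in>H \<inter> rist T G \<phi> u. g \<otimes> k \<noteq> k \<otimes> g"
proof -
  obtain g where g: "g \<in> H \<inter> rist T G \<phi> u" "g \<noteq> \<one>" using saturating_rist_nontrivial assms by blast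
  then obtain x where x: "x \<in> subtree T u" "\<phi> g x \<noteq> x" using rist_moves by blast
  obtain k where k: "k \<in> H \<inter> rist T G \<phi> x" "k \<noteq> \<one>"
    using saturating_rist_nontrivial[OF H v] x u subtree_trans by blast
  have G: "g \<in> carrier G" "k \<in> carrier G" using g k saturatingD(2)[OF H] by blast+
  have "k \<otimes> (g \<otimes> inv k \<otimes> inv g) \<noteq> \<one>" using commutator_nontrivial[OF G(1) x(2) _ k(2)] k(1) by blast
  have "g \<otimes> k \<noteq> k \<otimes> g"
  proof
    assume gk: "g \<otimes> k = k \<otimes> g"
    have "k \<otimes> (g \<otimes> inv k \<otimes> inv g) = (k \<otimes> g) \<otimes> inv (g \<otimes> k)"
      using G by (simp add: m_assoc inv_mult_group)
    also have "\<dots> = \<one>" using G by (simp add: gk)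
    finally show False using \<open>k \<otimes> (g \<otimes> inv k \<otimes> inv g) \<noteq> \<one>\<close> by contradiction
  qed
  then show ?thesis using g k rist_mono x by blast
qed

text \<open>
  By transitivity of \<open>H\<close>, conjugates of the two given elements move the same vertex \<open>u\<close>. Taking
  commutators of these conjugates with elements of \<open>H\<close> supported below \<open>u\<close>, each of the two
  subgroups realises on the subtree at \<open>u\<close> the nonabelian group of all these elements.
\<close>

lemma normalised_subgroups_not_commuting:
  assumes H: "saturating T G \<phi> n H" and w: "w \<in> level T n"
    and X: "subgroup X G" "\<And>h x. h \<in> H \<Longrightarrow> x \<in> X \<Longrightarrow> h \<otimes> x \<otimes> inv h \<in> X"
    and Y: "subgroup Y G" "\<And>h y. h \<in> H \<Longrightarrow> y \<in> Y \<Longrightarrow> h \<otimes> y \<otimes> inv h \<in> Y"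
    and x: "x \<in> X \<inter> rist T G \<phi> w" "x \<noteq> \<one>" and y: "y \<in> Y \<inter> rist T G \<phi> w" "y \<noteq> \<one>"
  shows "\<exists>x\<in>X. \<exists>y\<in>Y. x \<otimes> y \<noteq> y \<otimes> x"
proof (rule ccontr)
  assume "\<not> ?thesis"
  then have comm: "x \<otimes> y = y \<otimes> x" if "x \<in> X" "y \<in> Y" for x y using that by blast
  have xG: "x \<in> carrier G" and yG: "y \<in> carrier G" using x y ristD by blast+
  obtain u1 where u1: "u1 \<in> subtree T w" "\<phi> x u1 \<noteq> u1" using rist_moves x by blast
  obtain u2 where u2: "u2 \<in> subtree T w" "\<phi> y u2 \<noteq> u2" using rist_moves y by blast
  define m where "m = max (depth T u1) (depth T u2)"
  obtain v1 where v1: "v1 \<in> subtree T w" "v1 \<in> level T m" "\<phi> x v1 \<noteq> v1"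
    using moves_descendant[OF xG u1] unfolding m_def by (metis max.cobounded1)
  obtain u where u: "u \<in> subtree T w" "u \<in> level T m" "\<phi> y u \<noteq> u"
    using moves_descendant[OF yG u2] unfolding m_def by (metis max.cobounded2)
  have "depth T v1 = depth T u" using v1 u by (simp add: level_def)
  then obtain h where h: "h \<in> H" "\<phi> h v1 = u"
    using saturatingD(5)[OF H w] v1 u by blast
  have hG: "h \<in> carrier G" using h saturatingD(2)[OF H] by blast
  have uV: "u \<in> verts T" "v1 \<in> verts T" using u v1 subtreeD by blast+
  define x' where "x' = h \<otimes> x \<otimes> inv h"
  have x': "x' \<in> X" "x' \<in> carrier G" unfolding x'_def using X h x xG hG by auto
  have "\<phi> x' u \<noteq> u"
  proof
    assume a: "\<phi> x' u = u"
    have "\<phi> (inv h) u = v1" using act_inv hG uV h by metis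
    then have "\<phi> h (\<phi> x v1) = \<phi> h v1" using a h uV xG hG by (simp add: x'_def act_mult act_mem)
    then show False using v1 aut_inj[OF act_aut[OF hG]] act_mem xG uV by simp
  qed
  obtain g k where gk: "g \<in> H \<inter> rist T G \<phi> u" "k \<in> H \<inter> rist T G \<phi> u" "g \<otimes> k \<noteq> k \<otimes> g"
    using saturating_rist_nonabelian[OF H w u(1)] by blast
  have G: "g \<in> carrier G" "k \<in> carrier G" using gk ristD by blast+
  define c where "c = g \<otimes> (x' \<otimes> inv g \<otimes> inv x')"
  define d where "d = k \<otimes> (y \<otimes> inv k \<otimes> inv y)"
  have "c \<in> X" unfolding c_def commutator_assoc[OF G(1) x'(2)]
    using subgroup.m_closed[OF X(1) X(2)[of g x']] subgroup.m_inv_closed[OF X(1) x'(1)] gk x' by blast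
  moreover have "d \<in> Y" unfolding d_def commutator_assoc[OF G(2) yG]
    using subgroup.m_closed[OF Y(1) Y(2)[of k y]] subgroup.m_inv_closed[OF Y(1), of y] gk y by blast
  ultimately have cd: "c \<otimes> d = d \<otimes> c" using comm by blast
  have cG: "c \<in> carrier G" "d \<in> carrier G" unfolding c_def d_def using G x' yG by auto
  have c: "\<phi> c z = \<phi> g z" if "z \<in> subtree T u" for z
    unfolding c_def using commutator_acts[OF x'(2) \<open>\<phi> x' u \<noteq> u\<close>] gk that by blast
  have d: "\<phi> d z = \<phi> k z" if "z \<in> subtree T u" for z
    unfolding d_def using commutator_acts[OF yG u(3)] gk that by blast
  have "g \<otimes> k = k \<otimes> g"
  proof (rule act_eqI)
    fix z assume z: "z \<in> verts T"
    show "\<phi> (g \<otimes> k) z = \<phi> (k \<otimes> g) z"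
    proof (cases "z \<in> subtree T u")
      case True
      have p: "\<phi> g z \<in> subtree T u" "\<phi> k z \<in> subtree T u" using True rist_preserves gk by blast+
      have "\<phi> (g \<otimes> k) z = \<phi> (c \<otimes> d) z" using z G cG True p by (simp add: act_mult c d)
      also have "\<dots> = \<phi> (k \<otimes> g) z" unfolding cd using z G cG True p by (simp add: act_mult c d)
      finally show ?thesis .
    next
      case False
      then have "\<phi> g z = z" "\<phi> k z = z" using z gk ristD(2)[of _ u z] by blast+
      then show ?thesis using z G by (simp add: act_mult)
    qed
  qed (use G in auto)
  then show False using gk by simp
qed

end

section \<open>Automorphisms of saturated weakly branch groups\<close>

text \<open>
  Two actions of \<open>G\<close> on the same tree with common saturating subgroups, later the given action
  and its composition with an automorphism of \<open>G\<close>. They turn out to be conjugate in the automorphism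
  group of the tree.
\<close>

locale weakly_branch_pair =
  one: weakly_branch_action T G \<phi> + two: weakly_branch_action T G \<psi>
  for T :: "'v rtree" and G :: "('g, 'm) monoid_scheme" (structure) and \<phi> \<psi> :: "'g \<Rightarrow> 'v \<Rightarrow> 'v" +
  assumes saturated: "1 \<le> n \<Longrightarrow> \<exists>H. saturating T G \<phi> n H \<and> saturating T G \<psi> n H"
begin

text \<open>
  The vertices of the two actions are matched by overlapping rigid stabilizers. Two conjugate
  actions satisfy this relation for corresponding vertices, and it is visible from \<open>G\<close> alone.
\<close>

definition corr where
  "corr v w \<longleftrightarrow> v \<in> verts T \<and> w \<in> verts T \<and> depth T v = depth T w \<and>
     (\<exists>b\<in>rist T G \<phi> v \<inter> rist T G \<psi> w. b \<noteq> \<one>)"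

lemma corr_saturating:
  assumes "corr v w" "v \<in> level T n" and H: "saturating T G \<phi> n H" "saturating T G \<psi> n H"
  shows "\<exists>b\<in>(H \<inter> rist T G \<phi> v) \<inter> rist T G \<psi> w. b \<noteq> \<one>"
proof -
  obtain b where b: "b \<in> rist T G \<phi> v" "b \<in> rist T G \<psi> w" "b \<noteq> \<one>"
    using assms by (auto simp: corr_def)
  have V: "v \<in> verts T" "w \<in> verts T" "w \<in> level T n" using assms by (auto simp: corr_def level_def)
  have bG: "b \<in> carrier G" using b one.ristD by blast
  obtain u where u: "u \<in> subtree T v" "\<phi> b u \<noteq> u" using one.rist_moves b by blast
  obtain g where g: "g \<in> H" "g \<in> rist T G \<phi> u" "g \<noteq> \<one>"
    using one.saturating_rist_nontrivial H assms(2) u by blast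
  have gG: "g \<in> carrier G" using g one.ristD by blast
  define c where "c = g \<otimes> (b \<otimes> inv g \<otimes> inv b)"
  have "c \<noteq> \<one>" unfolding c_def using one.commutator_nontrivial bG u g by blast
  moreover have "c \<in> H"
  proof -
    have "b \<otimes> inv g \<otimes> inv b \<in> H"
      using one.saturatingD(3)[OF H(1) subgroup.m_inv_closed[OF one.saturatingD(1)[OF H(1)] g(1)] bG] .
    then show ?thesis unfolding c_def using subgroup.m_closed[OF one.saturatingD(1)[OF H(1)] g(1)] by blast
  qed
  moreover have "c \<in> rist T G \<phi> v"
    unfolding c_def using subsetD[OF one.rist_mono[OF u(1)] g(2)] b(1)
    by (simp add: one.rist_mult one.rist_inv V)
  moreover have "g \<otimes> b \<otimes> inv g \<in> rist T G \<psi> w"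
    using two.rist_conj[OF b(2) gG V(2)] two.saturatingD(4)[OF H(2) g(1) V(3)] by simp
  then have "c \<in> rist T G \<psi> w"
    unfolding c_def one.commutator_assoc[OF gG bG]
    using b(2) by (simp add: two.rist_mult two.rist_inv V)
  ultimately show ?thesis by blast
qed

text \<open>
  Otherwise the rigid stabilizers of \<open>v\<close> and \<open>v'\<close>, which commute with each other, both meet the
  rigid stabilizer of \<open>w\<close> for the second action nontrivially. Intersected with \<open>H\<close> they are normalised by \<open>H\<close>,
  contrary to \<open>normalised_subgroups_not_commuting\<close> for the second action.
\<close>

lemma corr_left_unique:
  assumes "corr v w" "corr v' w"
  shows "v = v'"
proof (rule ccontr)
  assume ne: "v \<noteq> v'"
  define n where "n = depth T w"
  have V: "v \<in> verts T" "v' \<in> verts T" "w \<in> verts T" "v \<in> level T n" "v' \<in> level T n" "w \<in> level T n"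
    and d: "depth T v = n" "depth T v' = n"
    using assms by (auto simp: corr_def level_def n_def)
  have "n \<noteq> 0" using ne d V one.depth_0_iff by metis
  then obtain H where H: "saturating T G \<phi> n H" "saturating T G \<psi> n H" using saturated[of n] by auto
  have sub: "subgroup (H \<inter> rist T G \<phi> z) G"
    "\<And>h x. h \<in> H \<Longrightarrow> x \<in> H \<inter> rist T G \<phi> z \<Longrightarrow> h \<otimes> x \<otimes> inv h \<in> H \<inter> rist T G \<phi> z"
    if z: "z \<in> level T n" for z
  proof -
    have zV: "z \<in> verts T" using z by (simp add: level_def)
    show "subgroup (H \<inter> rist T G \<phi> z) G"
      using one.saturatingD(1)[OF H(1)] one.rist_subgroup[OF zV] by (rule one.subgroups_Inter_pair)
    show "h \<otimes> x \<otimes> inv h \<in> H \<inter> rist T G \<phi> z" if "h \<in> H" "x \<in> H \<inter> rist T G \<phi> z" for h x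
      using that one.rist_conj[of x z h] one.saturatingD(2-4)[OF H(1)] z zV by auto
  qed
  obtain b where b: "b \<in> (H \<inter> rist T G \<phi> v) \<inter> rist T G \<psi> w" "b \<noteq> \<one>"
    using corr_saturating[OF assms(1) V(4) H] by blast
  obtain b' where b': "b' \<in> (H \<inter> rist T G \<phi> v') \<inter> rist T G \<psi> w" "b' \<noteq> \<one>"
    using corr_saturating[OF assms(2) V(5) H] by blast
  have "\<exists>x\<in>H \<inter> rist T G \<phi> v. \<exists>y\<in>H \<inter> rist T G \<phi> v'. x \<otimes> y \<noteq> y \<otimes> x"
    using two.normalised_subgroups_not_commuting[OF H(2) V(6) sub[OF V(4)] sub[OF V(5)] b b'] .
  then obtain x y where "x \<in> rist T G \<phi> v" "y \<in> rist T G \<phi> v'" "x \<otimes> y \<noteq> y \<otimes> x" by blast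
  then show False using one.rist_commute[of x v y v'] ne d by simp
qed

text \<open>
  An element \<open>k\<close> of \<open>H\<close> in the rigid stabilizer of \<open>v\<close> moves some vertex \<open>u\<close> in the second
  action. A commutator of \<open>k\<close> with an element of \<open>H\<close> supported below \<open>u\<close> for the second action
  stays in the rigid stabilizer of \<open>v\<close>, because \<open>H\<close> fixes \<open>v\<close>, and belongs to that of the ancestor
  \<open>w\<close> of \<open>u\<close> on the level of \<open>v\<close>.
\<close>

lemma corr_exists:
  assumes v: "v \<in> verts T"
  shows "\<exists>w. corr v w"
proof (cases "v = root T")
  case True
  obtain b where "b \<in> rist T G \<phi> v" "b \<noteq> \<one>" using one.rist_nontrivial v by blast
  then show ?thesis using True v
    by (auto simp: corr_def one.subtree_root rist_def intro!: exI[of _ "root T"])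
next
  case False
  define n where "n = depth T v"
  have n: "1 \<le> n" "v \<in> level T n" using False v one.depth_0_iff[OF v] by (auto simp: n_def level_def)
  then obtain H where H: "saturating T G \<phi> n H" "saturating T G \<psi> n H" using saturated by blast
  obtain k where k: "k \<in> H" "k \<in> rist T G \<phi> v" "k \<noteq> \<one>"
    using one.saturating_rist_nontrivial[OF H(1) n(2) one.subtree_refl[OF v]] by blast
  have kG: "k \<in> carrier G" using k one.ristD by blast
  obtain u where u: "u \<in> verts T" "\<psi> k u \<noteq> u" using two.moves_vertex kG k by blast
  have du: "n \<le> depth T u"
  proof (rule ccontr)
    assume "\<not> n \<le> depth T u"
    then obtain x where "x \<in> level T n" "\<psi> k x \<noteq> x"
      using two.moves_descendant[OF kG one.subtree_refl[OF u(1)] u(2), of n] by auto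
    then show False using two.saturatingD(4)[OF H(2)] k by blast
  qed
  define w where "w = (parent T ^^ (depth T u - n)) u"
  have w: "w \<in> verts T" "depth T w = n" "u \<in> subtree T w"
    unfolding w_def using u du one.ancestor_mem one.depth_ancestor by (auto simp: subtree_def)
  then have wn: "w \<in> level T n" by (simp add: level_def)
  obtain g where g: "g \<in> H" "g \<in> rist T G \<psi> u" "g \<noteq> \<one>"
    using two.saturating_rist_nontrivial[OF H(2) wn w(3)] by blast
  have gG: "g \<in> carrier G" using g two.ristD by blast
  define c where "c = g \<otimes> (k \<otimes> inv g \<otimes> inv k)"
  have "c \<noteq> \<one>" unfolding c_def using two.commutator_nontrivial kG u g by blast
  moreover have "c \<in> rist T G \<psi> w"
  proof -
    have gw: "g \<in> rist T G \<psi> w" using g two.rist_mono w by blast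
    then have gi: "inv g \<in> rist T G \<psi> w" by (intro two.rist_inv w)
    have "k \<otimes> inv g \<otimes> inv k \<in> rist T G \<psi> w"
      using two.rist_conj[OF gi kG w(1)] two.saturatingD(4)[OF H(2) k(1) wn] by simp
    then show ?thesis unfolding c_def using gw by (simp add: two.rist_mult w)
  qed
  moreover have "c \<in> rist T G \<phi> v"
  proof -
    have "g \<otimes> k \<otimes> inv g \<in> rist T G \<phi> v"
      using one.rist_conj[OF k(2) gG v] one.saturatingD(4)[OF H(1) g(1) n(2)] by simp
    then show ?thesis
      unfolding c_def one.commutator_assoc[OF gG kG]
      using k(2) by (simp add: one.rist_mult one.rist_inv v)
  qed
  ultimately show ?thesis using v w n_def by (auto simp: corr_def)
qed

lemma corr_parent:
  assumes "corr v w" shows "corr (parent T v) (parent T w)"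
proof -
  obtain b where b: "b \<in> rist T G \<phi> v" "b \<in> rist T G \<psi> w" "b \<noteq> \<one>"
    using assms by (auto simp: corr_def)
  have V: "v \<in> verts T" "w \<in> verts T" "depth T v = depth T w" using assms by (auto simp: corr_def)
  have "b \<in> rist T G \<phi> (parent T v) \<inter> rist T G \<psi> (parent T w)"
    using b one.rist_mono[OF one.subtree_parent[OF V(1)]] two.rist_mono[OF one.subtree_parent[OF V(2)]]
    by blast
  then show ?thesis
    using b(3) V one.parent_mem one.depth_parent' unfolding corr_def by auto
qed

lemma corr_act:
  assumes "corr v w" "g \<in> carrier G"
  shows "corr (\<phi> g v) (\<psi> g w)"
proof -
  obtain b where b: "b \<in> rist T G \<phi> v" "b \<in> rist T G \<psi> w" "b \<noteq> \<one>"
    using assms by (auto simp: corr_def)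
  have V: "v \<in> verts T" "w \<in> verts T" "depth T v = depth T w" using assms by (auto simp: corr_def)
  have bG: "b \<in> carrier G" using b one.ristD by blast
  have "g \<otimes> b \<otimes> inv g \<noteq> \<one>"
  proof
    assume a: "g \<otimes> b \<otimes> inv g = \<one>"
    have "b = inv g \<otimes> (g \<otimes> b \<otimes> inv g) \<otimes> g"
      using bG assms(2) by (simp add: one.m_assoc one.inv_solve_left)
    then show False using b(3) bG assms(2) by (simp add: a)
  qed
  then show ?thesis
    using V assms(2) one.rist_conj[OF b(1) assms(2) V(1)] two.rist_conj[OF b(2) assms(2) V(2)]
    by (auto simp: corr_def one.act_mem two.act_mem one.aut_depth[OF one.act_aut] one.aut_depth[OF two.act_aut])
qed

lemma swap: "weakly_branch_pair T G \<psi> \<phi>"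
  using saturated by unfold_locales blast

lemma corr_swap: "weakly_branch_pair.corr T G \<psi> \<phi> w v \<longleftrightarrow> corr v w"
  unfolding corr_def weakly_branch_pair.corr_def[OF swap] by auto

lemma corr_right_unique: "corr v w \<Longrightarrow> corr v w' \<Longrightarrow> w = w'"
  using weakly_branch_pair.corr_left_unique[OF swap] by (simp add: corr_swap)

theorem intertwining_automorphism:
  "\<exists>s. tree_automorphism T s \<and> (\<forall>g\<in>carrier G. \<forall>v\<in>verts T. s (\<phi> g v) = \<psi> g (s v))"
proof -
  define s where "s v = (THE w. corr v w)" for v
  have s_eq: "s v = w" if "corr v w" for v w
    unfolding s_def using that corr_right_unique by blast
  have s: "corr v (s v)" if v: "v \<in> verts T" for v
    using corr_exists[OF v] s_eq by blast
  have mem: "w \<in> verts T" "v \<in> verts T" if "corr v w" for v w using that by (auto simp: corr_def)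
  have "tree_automorphism T s"
    unfolding tree_automorphism_def
  proof (intro conjI ballI)
    show "bij_betw s (verts T) (verts T)"
    proof (rule bij_betw_imageI)
      show "inj_on s (verts T)" by (rule inj_onI) (metis s corr_left_unique)
      show "s ` verts T = verts T"
      proof
        show "s ` verts T \<subseteq> verts T" using s mem by blast
        show "verts T \<subseteq> s ` verts T"
        proof
          fix w assume "w \<in> verts T"
          then obtain v where "corr v w"
            using weakly_branch_pair.corr_exists[OF swap] corr_swap by blast
          then show "w \<in> s ` verts T" using s_eq mem by blast
        qed
      qed
    qed
    show "s (root T) = root T"
      using s[OF one.root_mem] one.depth_0_iff unfolding corr_def by (metis one.depth_root)
    show "s (parent T v) = parent T (s v)" if "v \<in> verts T" for v
      using s_eq[OF corr_parent[OF s[OF that]]] .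
  qed
  moreover have "s (\<phi> g v) = \<psi> g (s v)" if "g \<in> carrier G" "v \<in> verts T" for g v
    using s_eq[OF corr_act[OF s[OF that(2)] that(1)]] .
  ultimately show ?thesis by blast
qed

end

section \<open>Twisted conjugacy on one level\<close>

context tree_action
begin

text \<open>
  In the automorphism group of the tree, \<open>f\<close> conjugates the image of \<open>G\<close> into itself.
\<close>

definition normalises_action where
  "normalises_action f \<longleftrightarrow> tree_automorphism T f \<and>
     (\<forall>g\<in>carrier G. \<exists>g'\<in>carrier G. \<forall>x\<in>verts T. f (\<phi> g x) = \<phi> g' (f x))"

lemma normalises_act: "h \<in> carrier G \<Longrightarrow> normalises_action (\<phi> h)"
  unfolding normalises_action_def
proof (intro conjI ballI)
  fix g assume "h \<in> carrier G" "g \<in> carrier G"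
  then show "\<exists>g'\<in>carrier G. \<forall>x\<in>verts T. \<phi> h (\<phi> g x) = \<phi> g' (\<phi> h x)"
    by (intro bexI[of _ "h \<otimes> g \<otimes> inv h"]) (auto simp: act_mult act_mem act_inv)
qed (rule act_aut)

lemma normalises_comp:
  assumes f: "normalises_action f" and g: "normalises_action g"
  shows "normalises_action (f \<circ> g)"
  unfolding normalises_action_def
proof (intro conjI ballI)
  have autf: "tree_automorphism T f" and autg: "tree_automorphism T g"
    using f g by (auto simp: normalises_action_def)
  show "tree_automorphism T (f \<circ> g)" using autf autg by (rule aut_comp)
  fix k assume "k \<in> carrier G"
  then obtain k' where k': "k' \<in> carrier G" "\<forall>x\<in>verts T. g (\<phi> k x) = \<phi> k' (g x)"
    using g unfolding normalises_action_def by blast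
  then obtain k'' where "k'' \<in> carrier G" "\<forall>x\<in>verts T. f (\<phi> k' x) = \<phi> k'' (f x)"
    using f unfolding normalises_action_def by blast
  then show "\<exists>k'\<in>carrier G. \<forall>x\<in>verts T. (f \<circ> g) (\<phi> k x) = \<phi> k' ((f \<circ> g) x)"
    using k' aut_mem[OF autg] by auto
qed

lemma normalises_funpow:
  assumes "normalises_action f" shows "normalises_action (f ^^ k)"
proof (induction k)
  case 0
  then show ?case using aut_id by (auto simp: normalises_action_def id_def)
next
  case (Suc k)
  have "f ^^ Suc k = f \<circ> f ^^ k" by simp
  then show ?case using normalises_comp[OF assms Suc] by (simp only:)
qed

lemma local_subgroup_iff:
  assumes "v \<in> level T n"
  shows "a \<in> local_subgroup T G \<phi> v \<longleftrightarrow> a \<in> carrier G \<and> \<phi> a v = v \<and>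
    (\<forall>u\<in>level T (Suc n). parent T u \<noteq> v \<longrightarrow> \<phi> a u = u)"
  (is "?L \<longleftrightarrow> ?R")
proof
  have d: "depth T v = n" using assms by (simp add: level_def)
  {
    assume a: ?L
    show ?R
    proof (intro conjI ballI impI)
      fix u assume u: "u \<in> level T (Suc n)" "parent T u \<noteq> v"
      then have "u \<in> children T (parent T u)" "parent T u \<in> level T n"
        by (auto simp: level_def children_iff_depth parent_mem depth_parent')
      then show "\<phi> a u = u" using a u d unfolding local_subgroup_def stabilizer_def by blast
    qed (use a in \<open>auto simp: local_subgroup_def stabilizer_def\<close>)
  }
  assume a: ?R
  have "u \<in> level T (Suc n) \<and> parent T u = w" if "w \<in> level T n" "u \<in> children T w" for u w
    using that childrenD[of u w] by (auto simp: level_def)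
  then show ?L using a d unfolding local_subgroup_def stabilizer_def by fastforce
qed

lemma local_subgroup_fixes:
  assumes a: "a \<in> local_subgroup T G \<phi> v" and v: "v \<in> level T n" and w: "w \<in> verts T" "depth T w \<le> n"
  shows "\<phi> a w = w"
proof -
  have A: "a \<in> carrier G" using a local_subgroup_iff[OF v] by blast
  obtain x where x: "x \<in> subtree T w" "x \<in> level T n" using descendant_exists w by blast
  have "\<phi> a x = x"
  proof (cases "x = v")
    case True
    then show ?thesis using a local_subgroup_iff[OF v] by blast
  next
    case False
    obtain u where u: "u \<in> children T x" using has_child x(2) by (auto simp: level_def)
    then have "u \<in> level T (Suc n)" "parent T u = x" using childrenD[OF u] x by (auto simp: level_def)
    moreover have "u \<in> subtree T x" using subtree_parent[OF childrenD(1)[OF u]] childrenD(3)[OF u] by simp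
    ultimately show ?thesis
      using a local_subgroup_iff[OF v] False fixes_ancestor[OF A] by metis
  qed
  then show ?thesis using fixes_ancestor[OF A x(1)] by blast
qed

lemma local_subgroup_mult:
  assumes v: "v \<in> level T n" and a: "a \<in> local_subgroup T G \<phi> v" and b: "b \<in> local_subgroup T G \<phi> v"
  shows "a \<otimes> b \<in> local_subgroup T G \<phi> v"
  using a b v unfolding local_subgroup_iff[OF v] by (auto simp: act_mult level_def)

lemma local_subgroup_inv:
  assumes v: "v \<in> level T n" and a: "a \<in> local_subgroup T G \<phi> v"
  shows "inv a \<in> local_subgroup T G \<phi> v"
proof -
  have aG: "a \<in> carrier G" using a local_subgroup_iff[OF v] by blast
  have "\<phi> (inv a) u = u" if "u \<in> verts T" "\<phi> a u = u" for u
    using act_inv(1)[OF aG that(1)] that(2) by simp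
  then show ?thesis using a v unfolding local_subgroup_iff[OF v] by (auto simp: level_def)
qed

lemma local_subgroup_one: "v \<in> level T n \<Longrightarrow> \<one> \<in> local_subgroup T G \<phi> v"
  by (auto simp: local_subgroup_iff act_one level_def)

text \<open>
  The extension by the identity makes this a permutation of the set of immediate descendants
  whenever \<open>f\<close> fixes \<open>v\<close>.
\<close>

definition child_perm where
  "child_perm v f = (\<lambda>u. if u \<in> children T v then f u else u)"

definition local_perms where
  "local_perms v = (\<lambda>a. child_perm v (\<phi> a)) ` local_subgroup T G \<phi> v"

lemma aut_child:
  assumes "tree_automorphism T f" "f v = v" "u \<in> children T v"
  shows "f u \<in> children T v"
  using aut_children[OF assms(1) childrenD(1,2)[OF assms(3)]] assms by simp

lemma child_perm_permutes:
  assumes f: "tree_automorphism T f" "f v = v" and fin: "finite (children T v)"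
  shows "child_perm v f permutes children T v"
proof (rule bij_imp_permutes)
  have "inj_on f (children T v)"
    by (rule inj_onI) (metis aut_inj[OF f(1)] childrenD(1))
  then have "f ` children T v = children T v"
    using aut_child[OF f] fin by (intro endo_inj_surj) auto
  with \<open>inj_on f _\<close> have "bij_betw f (children T v) (children T v)" by (simp add: bij_betw_def)
  then show "bij_betw (child_perm v f) (children T v) (children T v)"
    by (subst bij_betw_cong[of _ _ f]) (auto simp: child_perm_def)
qed (simp add: child_perm_def)

lemma child_perm_comp:
  assumes "tree_automorphism T g" "g v = v"
  shows "child_perm v f \<circ> child_perm v g = child_perm v (f \<circ> g)"
  using aut_child[OF assms] by (auto simp: child_perm_def fun_eq_iff)

lemma child_perm_cong:
  "(\<And>u. u \<in> children T v \<Longrightarrow> f u = g u) \<Longrightarrow> child_perm v f = child_perm v g"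
  by (auto simp: child_perm_def)

lemma local_perms_prime_degree:
  assumes v: "v \<in> level T n" and p: "prime p" "card (children T v) = p"
    and tr: "transitive_on \<phi> (local_subgroup T G \<phi> v) (children T v)"
  shows "prime_degree_group (children T v) (local_perms v) p"
proof
  show fin: "finite (children T v)" using p by (metis card.infinite not_prime_0)
  have L: "a \<in> carrier G" "tree_automorphism T (\<phi> a)" "\<phi> a v = v"
    if "a \<in> local_subgroup T G \<phi> v" for a
    using that local_subgroup_iff[OF v] act_aut by blast+
  have mult: "child_perm v (\<phi> a) \<circ> child_perm v (\<phi> b) = child_perm v (\<phi> (a \<otimes> b))"
    if "a \<in> local_subgroup T G \<phi> v" "b \<in> local_subgroup T G \<phi> v" for a b
    using that L childrenD(1) by (simp add: child_perm_comp act_mult cong: child_perm_cong)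
  have one: "child_perm v (\<phi> \<one>) = id"
    using childrenD(1) by (auto simp: child_perm_def act_one)
  show "id \<in> local_perms v"
    unfolding local_perms_def using local_subgroup_one[OF v] one by (metis imageI)
  show "\<pi> permutes children T v" if "\<pi> \<in> local_perms v" for \<pi>
    using that child_perm_permutes[OF L(2,3) fin] by (auto simp: local_perms_def)
  show "\<pi> \<circ> \<rho> \<in> local_perms v" if "\<pi> \<in> local_perms v" "\<rho> \<in> local_perms v" for \<pi> \<rho>
    using that mult local_subgroup_mult[OF v] unfolding local_perms_def by auto
  show "pinv \<pi> \<in> local_perms v" if \<pi>: "\<pi> \<in> local_perms v" for \<pi>
  proof -
    obtain a where a: "a \<in> local_subgroup T G \<phi> v" "\<pi> = child_perm v (\<phi> a)"
      using \<pi> by (auto simp: local_perms_def)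
    have ai: "inv a \<in> local_subgroup T G \<phi> v" using local_subgroup_inv[OF v a(1)] .
    have "\<pi> \<circ> child_perm v (\<phi> (inv a)) = id" "child_perm v (\<phi> (inv a)) \<circ> \<pi> = id"
      using mult[OF a(1) ai] mult[OF ai a(1)] L[OF a(1)] one a(2) by auto
    then have "pinv \<pi> = child_perm v (\<phi> (inv a))" by (rule inv_unique_comp)
    then show ?thesis using ai by (simp add: local_perms_def)
  qed
  show "\<exists>\<pi>\<in>local_perms v. \<pi> x = y" if xy: "x \<in> children T v" "y \<in> children T v" for x y
  proof -
    have "\<exists>a\<in>local_subgroup T G \<phi> v. \<phi> a x = y" using tr xy by (simp add: transitive_on_def)
    then obtain a where "a \<in> local_subgroup T G \<phi> v" "\<phi> a x = y" by blast
    then show ?thesis using xy(1) by (auto simp: local_perms_def child_perm_def)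
  qed
qed (use p in auto)

text \<open>
  The group \<open>G\<^bsub>{v}\<^esub>\<close> is described by the vertices that it fixes, and conjugation by an
  automorphism of the tree fixing \<open>v\<close> preserves this description.
\<close>

lemma normalises_local_perms:
  assumes P: "prime_degree_group (children T v) (local_perms v) p"
    and v: "v \<in> level T n" and f: "normalises_action f" "f v = v"
  shows "prime_degree_group.normalises (children T v) (local_perms v) (child_perm v f)"
  unfolding prime_degree_group.normalises_def[OF P]
proof (intro conjI ballI)
  have aut: "tree_automorphism T f" using f by (simp add: normalises_action_def)
  have fin: "finite (children T v)"
    using P by (simp add: prime_degree_group_def perm_group_def)
  show "child_perm v f permutes children T v" using child_perm_permutes[OF aut f(2) fin] .
  fix \<pi> assume "\<pi> \<in> local_perms v"
  then obtain a where a: "a \<in> local_subgroup T G \<phi> v" "\<pi> = child_perm v (\<phi> a)"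
    by (auto simp: local_perms_def)
  have aG: "a \<in> carrier G" "\<phi> a v = v" using a local_subgroup_iff[OF v] by blast+
  obtain g where g: "g \<in> carrier G" "\<And>x. x \<in> verts T \<Longrightarrow> f (\<phi> a x) = \<phi> g (f x)"
    using f aG unfolding normalises_action_def by blast
  have vV: "v \<in> verts T" using v by (simp add: level_def)
  have gl: "g \<in> local_subgroup T G \<phi> v"
    unfolding local_subgroup_iff[OF v]
  proof (intro conjI ballI impI)
    show "\<phi> g v = v" using g(2)[OF vV] aG f by simp
    fix u assume u: "u \<in> level T (Suc n)" "parent T u \<noteq> v"
    then have uV: "u \<in> verts T" by (simp add: level_def)
    then obtain x where x: "x \<in> verts T" "f x = u" using aut_surj[OF aut] by blast
    have "x \<in> level T (Suc n)" using x u aut_depth[OF aut x(1)] by (simp add: level_def)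
    moreover have "parent T x \<noteq> v" using aut_parent[OF aut x(1)] x u f by auto
    ultimately have "\<phi> a x = x" using a local_subgroup_iff[OF v] by blast
    then show "\<phi> g u = u" using g(2)[OF x(1)] x by simp
  qed (rule g)
  have gv: "\<phi> g v = v" using gl local_subgroup_iff[OF v] by blast
  have "child_perm v f \<circ> \<pi> = child_perm v (\<phi> g) \<circ> child_perm v f"
    unfolding a(2) child_perm_comp[OF act_aut[OF aG(1)] aG(2)] child_perm_comp[OF aut f(2)]
    using g(2) childrenD(1) by (intro child_perm_cong) simp
  then show "\<exists>\<rho>\<in>local_perms v. child_perm v f \<circ> \<pi> = \<rho> \<circ> child_perm v f"
    using gl by (auto simp: local_perms_def)
qed

lemma aut_period:
  assumes f: "tree_automorphism T f" and v: "v \<in> level T n" and fin: "finite (level T n)"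
  shows "\<exists>m>0. (f ^^ m) v = v"
proof -
  have mem: "(f ^^ k) v \<in> level T n" for k using aut_level[OF aut_funpow[OF f] v] .
  have "\<not> inj (\<lambda>k. (f ^^ k) v)"
    using mem fin by (metis finite_imageD finite_subset image_subsetI infinite_UNIV_nat)
  then obtain i j where ij: "(f ^^ i) v = (f ^^ j) v" "i < j"
    unfolding inj_def by (metis linorder_neqE_nat)
  have "(f ^^ j) v = (f ^^ i) ((f ^^ (j - i)) v)"
    using ij(2) by (metis comp_apply funpow_add le_add_diff_inverse less_imp_le)
  then have "(f ^^ i) ((f ^^ (j - i)) v) = (f ^^ i) v" using ij by simp
  then have "(f ^^ (j - i)) v = v"
    using aut_inj[OF aut_funpow[OF f]] mem v by (auto simp: level_def)
  then show ?thesis using ij(2) by (intro exI[of _ "j - i"]) auto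
qed

text \<open>
  Let \<open>x\<close> be the action of \<open>h\<close> and \<open>y = s e\<close>, so that \<open>x\<close> conjugates \<open>s\<close> into \<open>y\<close> on level
  \<open>n + 1\<close>. Then \<open>x\<close> permutes the orbits of \<open>s\<close> on level \<open>n\<close> and may move the orbit \<open>Q\<close> of \<open>v\<close>
  elsewhere. Let \<open>q\<close> be the first positive exponent for which \<open>x\<^sup>q\<close> returns to \<open>Q\<close>. The maps \<open>s\<close>
  and \<open>y\<close> differ only below \<open>v\<close>, and the intermediate orbits avoid \<open>v\<close>, so below \<open>Q\<close> the power
  \<open>x\<^sup>q\<close> still conjugates \<open>s\<close> into \<open>y\<close>. Composed with a power of \<open>y\<close> that brings \<open>x\<^sup>q v\<close> back to
  \<open>v\<close>, it fixes \<open>v\<close> and conjugates the first return \<open>s\<^sup>m\<close> into \<open>y\<^sup>m\<close>. Finally \<open>y\<^sup>m = s\<^sup>m e\<close>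
  below \<open>v\<close>, as the path of \<open>v\<close> under \<open>y\<close> meets \<open>v\<close> only at its start before time \<open>m\<close>.
\<close>

lemma first_return_conjugate:
  assumes v: "v \<in> level T n" and fin: "finite (level T n)"
    and s: "normalises_action s"
    and m: "0 < m" "(s ^^ m) v = v" "\<And>k. 0 < k \<Longrightarrow> k < m \<Longrightarrow> (s ^^ k) v \<noteq> v"
    and e: "e \<in> local_subgroup T G \<phi> v" and h: "h \<in> carrier G"
    and conj: "\<And>u. u \<in> level T (Suc n) \<Longrightarrow> \<phi> h (s u) = s (\<phi> e (\<phi> h u))"
  shows "\<exists>f. normalises_action f \<and> f v = v \<and>
    (\<forall>u\<in>children T v. f ((s ^^ m) u) = (s ^^ m) (\<phi> e (f u)))"
proof -
  have eG: "e \<in> carrier G" using e local_subgroup_iff[OF v] by blast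
  have e_fix: "\<phi> e u = u" if "u \<in> level T (Suc n)" "parent T u \<noteq> v" for u
    using that e local_subgroup_iff[OF v] by blast
  have e_level: "\<phi> e w = w" if "w \<in> level T n" for w
    using local_subgroup_fixes[OF e v, of w] that by (auto simp: level_def)
  define x where "x = \<phi> h"
  define y where "y = s \<circ> \<phi> e"
  have auts: "tree_automorphism T s" using s by (simp add: normalises_action_def)
  have ny: "normalises_action y" unfolding y_def using normalises_comp[OF s normalises_act[OF eG]] .
  then have auty: "tree_automorphism T y" by (simp add: normalises_action_def)
  have autx: "tree_automorphism T x" unfolding x_def using act_aut[OF h] .
  note autsk = aut_funpow[OF auts] and autxk = aut_funpow[OF autx] and autyk = aut_funpow[OF auty]
  have lV: "w \<in> verts T" if "w \<in> level T k" for w k using that by (simp add: level_def)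
  have xs: "x (s u) = y (x u)" if "u \<in> level T (Suc n)" for u
    using conj[OF that] by (simp add: x_def y_def)
  have ys: "y w = s w" if "w \<in> level T n" for w using e_level[OF that] by (simp add: y_def)
  have ys': "y u = s u" if "u \<in> level T (Suc n)" "parent T u \<noteq> v" for u
    using e_fix[OF that] by (simp add: y_def)
  have comm: "x (s w) = s (x w)" if w: "w \<in> level T n" for w
  proof -
    obtain u where u: "u \<in> children T w" using has_child lV[OF w] by blast
    have ul: "u \<in> level T (Suc n)" and uV: "u \<in> verts T" and pu: "parent T u = w"
      using childrenD[OF u] w by (auto simp: level_def)
    have "parent T (x (s u)) = x (s w)"
      using aut_parent[OF autx] aut_parent[OF auts] aut_mem[OF auts] uV pu by simp
    moreover have "parent T (y (x u)) = y (x w)"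
      using aut_parent[OF autx] aut_parent[OF auty] aut_mem[OF autx] uV pu by simp
    ultimately have "x (s w) = y (x w)" using xs[OF ul] by simp
    then show ?thesis using ys[OF aut_level[OF autx w]] by simp
  qed
  have commk: "(x ^^ j) ((s ^^ k) w) = (s ^^ k) ((x ^^ j) w)" if w: "w \<in> level T n" for w j k
  proof -
    have 1: "x ((s ^^ k) w) = (s ^^ k) (x w)" if w: "w \<in> level T n" for w
    proof (induction k)
      case (Suc k)
      have "x ((s ^^ Suc k) w) = s (x ((s ^^ k) w))"
        using comm[OF aut_level[OF autsk w]] by simp
      then show ?case using Suc by simp
    qed simp
    show ?thesis
    proof (induction j)
      case (Suc j)
      then show ?case using 1[OF aut_level[OF autxk w]] by simp
    qed simp
  qed
  define Q where "Q = range (\<lambda>k. (s ^^ k) v)"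
  have ex: "\<exists>q. 0 < q \<and> (x ^^ q) v \<in> Q"
    using aut_period[OF autx v fin] unfolding Q_def by (metis funpow_0 rangeI)
  define q where "q = (LEAST q. 0 < q \<and> (x ^^ q) v \<in> Q)"
  have q: "0 < q" "(x ^^ q) v \<in> Q"
    using LeastI_ex[OF ex] unfolding q_def by auto
  have q_min: "(x ^^ j) v \<notin> Q" if "0 < j" "j < q" for j
    using that not_less_Least[of j "\<lambda>q. 0 < q \<and> (x ^^ q) v \<in> Q"] unfolding q_def by blast
  \<comment> \<open>The orbit \<open>x\<^sup>j Q\<close> would otherwise meet, hence equal, \<open>Q\<close>.\<close>
  have Q_away: "(x ^^ j) w \<noteq> v" if w: "w \<in> Q" and j: "0 < j" "j < q" for w j
  proof
    assume a: "(x ^^ j) w = v"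
    obtain k where k: "w = (s ^^ k) v" using w by (auto simp: Q_def)
    define z where "z = (x ^^ j) v"
    have "(s ^^ k) z = v" using a commk[OF v] by (simp add: k z_def)
    moreover have "(s ^^ m) z = z" using commk[OF v, of j m] m by (simp add: z_def)
    then have "(s ^^ (k * m)) z = z" by (rule funpow_mult_fixed)
    moreover have "k * m = k * (m - 1) + k" using m by (cases m) auto
    ultimately have "z = (s ^^ (k * (m - 1))) v" by (simp add: funpow_add)
    then show False using q_min[OF j] by (auto simp: Q_def z_def)
  qed
  have Q_level: "w \<in> level T n" if "w \<in> Q" for w
    using that aut_level[OF autsk v] by (auto simp: Q_def)
  have Q_s: "(s ^^ k) w \<in> Q" if "w \<in> Q" for w k
    using that unfolding Q_def by (auto simp flip: funpow_add[THEN fun_cong, unfolded comp_apply])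
  have below: "(x ^^ j) (s u) = s ((x ^^ j) u)"
    if u: "u \<in> level T (Suc n)" "parent T u \<in> Q" and j: "j < q" for u j
    using j
  proof (induction j)
    case (Suc j)
    have l: "(x ^^ k) u \<in> level T (Suc n)" for k using aut_level[OF autxk u(1)] .
    have "parent T ((x ^^ Suc j) u) = (x ^^ Suc j) (parent T u)"
      using aut_parent[OF autxk] lV[OF u(1)] by blast
    then have ne: "parent T ((x ^^ Suc j) u) \<noteq> v" using Q_away[OF u(2), of "Suc j"] Suc by simp
    have "(x ^^ Suc j) (s u) = x (s ((x ^^ j) u))" using Suc by simp
    also have "\<dots> = y ((x ^^ Suc j) u)" using xs[OF l] by simp
    also have "\<dots> = s ((x ^^ Suc j) u)" using ys'[OF l ne] .
    finally show ?case .
  qed simp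
  define X where "X = x ^^ q"
  have X1: "X (s u) = y (X u)" if u: "u \<in> level T (Suc n)" "parent T u \<in> Q" for u
  proof -
    obtain j where j: "q = Suc j" using q by (cases q) auto
    have "X (s u) = x (s ((x ^^ j) u))" using below[OF u, of j] j by (simp add: X_def)
    also have "\<dots> = y (X u)" using xs[OF aut_level[OF autxk u(1)]] by (simp add: X_def j)
    finally show ?thesis .
  qed
  have Xk: "X ((s ^^ k) u) = (y ^^ k) (X u)" if u: "u \<in> level T (Suc n)" "parent T u \<in> Q" for u k
  proof (induction k)
    case (Suc k)
    have "parent T ((s ^^ k) u) \<in> Q" using aut_parent[OF autsk] lV[OF u(1)] Q_s u by simp
    then have "X ((s ^^ Suc k) u) = y (X ((s ^^ k) u))" using X1[OF aut_level[OF autsk u(1)]] by simp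
    then show ?case using Suc by simp
  qed simp
  obtain t where t: "X v = (s ^^ t) v" using q unfolding X_def Q_def by auto
  \<comment> \<open>On level \<open>n\<close>, \<open>y\<close> acts as \<open>s\<close>, and \<open>t (m - 1) + t\<close> is a multiple of the period \<open>m\<close> of \<open>v\<close>.\<close>
  define f where "f = y ^^ (t * (m - 1)) \<circ> X"
  have ysk: "(y ^^ k) w = (s ^^ k) w" if "w \<in> level T n" for k w
    using ys aut_level[OF autsk that] by (induction k) auto
  have fv: "f v = v"
  proof -
    have "f v = (s ^^ (t * (m - 1))) ((s ^^ t) v)"
      unfolding f_def using t ysk[OF aut_level[OF autsk v]] by simp
    also have "\<dots> = (s ^^ (t * (m - 1) + t)) v" by (simp add: funpow_add)
    also have "t * (m - 1) + t = t * m" using m by (cases m) auto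
    finally show ?thesis using funpow_mult_fixed[OF m(2)] by simp
  qed
  have nX: "normalises_action X" unfolding X_def x_def using normalises_funpow[OF normalises_act[OF h]] .
  have nf: "normalises_action f" unfolding f_def using normalises_comp[OF normalises_funpow[OF ny] nX] .
  then have autf: "tree_automorphism T f" by (simp add: normalises_action_def)
  have ym: "(y ^^ m) u = (s ^^ m) (\<phi> e u)" if u: "u \<in> children T v" for u
  proof -
    have ul: "u \<in> level T (Suc n)" "parent T u = v" using childrenD[OF u] v by (auto simp: level_def)
    have eu: "\<phi> e u \<in> level T (Suc n)" "parent T (\<phi> e u) = v"
      using aut_level[OF act_aut[OF eG] ul(1)] aut_parent[OF act_aut[OF eG] lV[OF ul(1)]] ul
        e_level[OF v] by auto
    have "(y ^^ Suc k) u = (s ^^ Suc k) (\<phi> e u)" if "Suc k \<le> m" for k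
      using that
    proof (induction k)
      case (Suc k)
      have l: "(s ^^ Suc k) (\<phi> e u) \<in> level T (Suc n)" using aut_level[OF autsk eu(1)] .
      have "parent T ((s ^^ Suc k) (\<phi> e u)) = (s ^^ Suc k) v"
        using aut_parent[OF autsk lV[OF eu(1)]] by (simp only: eu(2))
      then have "parent T ((s ^^ Suc k) (\<phi> e u)) \<noteq> v" using m(3)[of "Suc k"] Suc by simp
      then have "y ((s ^^ Suc k) (\<phi> e u)) = s ((s ^^ Suc k) (\<phi> e u))" using ys'[OF l] by blast
      then show ?case using Suc by simp
    qed (simp add: y_def)
    from this[of "m - 1"] show ?thesis using m by simp
  qed
  have "f ((s ^^ m) u) = (s ^^ m) (\<phi> e (f u))" if u: "u \<in> children T v" for u
  proof -
    have ul: "u \<in> level T (Suc n)" "parent T u = v" using childrenD[OF u] v by (auto simp: level_def)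
    have "parent T u \<in> Q" using ul by (auto simp: Q_def intro!: range_eqI[of _ _ 0])
    then have "f ((s ^^ m) u) = (y ^^ (t * (m - 1))) ((y ^^ m) (X u))"
      using Xk[OF ul(1)] by (simp add: f_def)
    also have "\<dots> = (y ^^ m) (f u)"
      unfolding f_def by (metis add.commute comp_apply funpow_add)
    also have "\<dots> = (s ^^ m) (\<phi> e (f u))" using ym[OF aut_child[OF autf fv u]] .
    finally show ?thesis .
  qed
  then show ?thesis using nf fv by blast
qed

text \<open>
  Otherwise \<open>first_return_conjugate\<close> makes all elements of the coset \<open>c A\<close> conjugate to \<open>c\<close>, for
  the first return \<open>c\<close> of \<open>s\<close> to \<open>v\<close> and the group \<open>A\<close> induced by \<open>G\<^bsub>{v}\<^esub>\<close>, and \<open>A\<close> would be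
  abelian.
\<close>

theorem level_class_splits:
  assumes v: "v \<in> level T n" and fin: "finite (level T n)"
    and s: "normalises_action s"
    and p: "prime p" "card (children T v) = p"
    and tr: "transitive_on \<phi> (local_subgroup T G \<phi> v) (children T v)"
    and nonab: "a \<in> local_subgroup T G \<phi> v" "b \<in> local_subgroup T G \<phi> v"
      "u \<in> children T v" "\<phi> a (\<phi> b u) \<noteq> \<phi> b (\<phi> a u)"
  shows "\<exists>e\<in>local_subgroup T G \<phi> v. \<forall>h\<in>carrier G.
    \<exists>u\<in>level T (Suc n). \<phi> h (s u) \<noteq> s (\<phi> e (\<phi> h u))"
proof (rule ccontr)
  assume "\<not> ?thesis"
  then have conj: "\<exists>h\<in>carrier G. \<forall>u\<in>level T (Suc n). \<phi> h (s u) = s (\<phi> e (\<phi> h u))"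
    if "e \<in> local_subgroup T G \<phi> v" for e using that by blast
  have auts: "tree_automorphism T s" using s by (simp add: normalises_action_def)
  have ex: "\<exists>m. 0 < m \<and> (s ^^ m) v = v" using aut_period[OF auts v fin] by blast
  define m where "m = (LEAST m. 0 < m \<and> (s ^^ m) v = v)"
  have m: "0 < m" "(s ^^ m) v = v" using LeastI_ex[OF ex] unfolding m_def by auto
  have m_min: "(s ^^ k) v \<noteq> v" if "0 < k" "k < m" for k
    using that not_less_Least[of k "\<lambda>m. 0 < m \<and> (s ^^ m) v = v"] unfolding m_def by blast
  have P: "prime_degree_group (children T v) (local_perms v) p"
    using local_perms_prime_degree[OF v p tr] .
  interpret P: prime_degree_group "children T v" "local_perms v" p by (rule P)
  define c where "c = child_perm v (s ^^ m)"
  have "P.normalises c"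
    unfolding c_def using normalises_local_perms[OF P v normalises_funpow[OF s] m(2)] .
  moreover have "\<exists>f. P.normalises f \<and> f \<circ> c = c \<circ> \<pi> \<circ> f" if \<pi>: "\<pi> \<in> local_perms v" for \<pi>
  proof -
    obtain e where e: "e \<in> local_subgroup T G \<phi> v" "\<pi> = child_perm v (\<phi> e)"
      using \<pi> by (auto simp: local_perms_def)
    have eG: "e \<in> carrier G" "\<phi> e v = v" using e local_subgroup_iff[OF v] by blast+
    obtain h where h: "h \<in> carrier G" "\<forall>u\<in>level T (Suc n). \<phi> h (s u) = s (\<phi> e (\<phi> h u))"
      using conj[OF e(1)] by blast
    obtain f where f: "normalises_action f" "f v = v"
      "\<And>u. u \<in> children T v \<Longrightarrow> f ((s ^^ m) u) = (s ^^ m) (\<phi> e (f u))"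
      using first_return_conjugate[OF v fin s m m_min e(1) h(1)] h(2) by blast
    have autf: "tree_automorphism T f" using f by (simp add: normalises_action_def)
    have "child_perm v f \<circ> c = child_perm v (f \<circ> s ^^ m)"
      unfolding c_def using child_perm_comp[OF aut_funpow[OF auts] m(2)] .
    also have "\<dots> = child_perm v ((s ^^ m \<circ> \<phi> e) \<circ> f)"
      using f(3) by (intro child_perm_cong) simp
    also have "\<dots> = c \<circ> \<pi> \<circ> child_perm v f"
      unfolding c_def e(2) child_perm_comp[OF act_aut[OF eG(1)] eG(2)]
      using child_perm_comp[OF autf f(2)] by simp
    finally show ?thesis using normalises_local_perms[OF P v f(1,2)] by blast
  qed
  ultimately have ab: "\<forall>\<pi>\<in>local_perms v. \<forall>\<rho>\<in>local_perms v. \<pi> \<circ> \<rho> = \<rho> \<circ> \<pi>"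
    using P.abelian_if_coset_conjugate by blast
  have AB: "a \<in> carrier G" "\<phi> a v = v" "b \<in> carrier G" "\<phi> b v = v"
    using nonab local_subgroup_iff[OF v] by blast+
  have "(child_perm v (\<phi> a) \<circ> child_perm v (\<phi> b)) u = (child_perm v (\<phi> b) \<circ> child_perm v (\<phi> a)) u"
    using ab nonab(1,2) unfolding local_perms_def by (metis imageI)
  then show False
    using nonab(3,4) aut_child[OF act_aut[OF AB(1)] AB(2)] aut_child[OF act_aut[OF AB(3)] AB(4)]
    by (simp add: child_perm_def)
qed

end

section \<open>Non-commuting local subgroups\<close>

context monoid
begin

lemma foldr_mult_closed:
  "set xs \<subseteq> carrier G \<Longrightarrow> foldr (\<lambda>a c. a \<otimes> c) xs \<one> \<in> carrier G"
  by (induction xs) auto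

lemma foldr_mult_commute:
  assumes "set xs \<subseteq> carrier G" "set ys \<subseteq> carrier G"
    "\<And>x y. x \<in> set xs \<Longrightarrow> y \<in> set ys \<Longrightarrow> x \<otimes> y = y \<otimes> x"
  shows "foldr (\<lambda>a c. a \<otimes> c) xs \<one> \<otimes> foldr (\<lambda>a c. a \<otimes> c) ys \<one> =
    foldr (\<lambda>a c. a \<otimes> c) ys \<one> \<otimes> foldr (\<lambda>a c. a \<otimes> c) xs \<one>"
proof -
  have one: "x \<otimes> foldr (\<lambda>a c. a \<otimes> c) ys \<one> = foldr (\<lambda>a c. a \<otimes> c) ys \<one> \<otimes> x"
    if "x \<in> carrier G" "set ys \<subseteq> carrier G" "\<And>y. y \<in> set ys \<Longrightarrow> x \<otimes> y = y \<otimes> x" for x ys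
    using that(2,3)
  proof (induction ys)
    case (Cons y ys)
    let ?F = "foldr (\<lambda>a c. a \<otimes> c) ys \<one>"
    have c: "?F \<in> carrier G" "y \<in> carrier G" using Cons foldr_mult_closed by auto
    have "x \<otimes> (y \<otimes> ?F) = (x \<otimes> y) \<otimes> ?F" using c that by (simp add: m_assoc)
    also have "\<dots> = y \<otimes> (x \<otimes> ?F)" using c that Cons.prems by (simp add: m_assoc)
    also have "\<dots> = (y \<otimes> ?F) \<otimes> x" using c that Cons by (simp add: m_assoc)
    finally show ?case by simp
  qed (use that in simp)
  show ?thesis
    using assms(1,3)
  proof (induction xs)
    case Nil
    then show ?case using foldr_mult_closed[OF assms(2)] by simp
  next
    case (Cons x xs)
    let ?X = "foldr (\<lambda>a c. a \<otimes> c) xs \<one>" and ?Y = "foldr (\<lambda>a c. a \<otimes> c) ys \<one>"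
    have c: "?X \<in> carrier G" "?Y \<in> carrier G" "x \<in> carrier G"
      using Cons foldr_mult_closed assms(2) by auto
    have "?X \<otimes> ?Y = ?Y \<otimes> ?X" by (rule Cons.IH) (use Cons.prems in auto)
    then have "(x \<otimes> ?X) \<otimes> ?Y = x \<otimes> (?Y \<otimes> ?X)" using c by (simp add: m_assoc)
    also have "\<dots> = (x \<otimes> ?Y) \<otimes> ?X" using c by (simp add: m_assoc)
    also have "x \<otimes> ?Y = ?Y \<otimes> x" using one[OF c(3) assms(2)] Cons.prems by auto
    also have "(?Y \<otimes> x) \<otimes> ?X = ?Y \<otimes> (x \<otimes> ?X)" using c by (simp add: m_assoc)
    finally show ?case by simp
  qed
qed

end

context tree_action
begin

lemma level_stabilizer_iff:
  "g \<in> level_stabilizer T G \<phi> i \<longleftrightarrow> g \<in> carrier G \<and> (\<forall>u\<in>level T i. \<phi> g u = u)"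
  by (auto simp: level_stabilizer_def stabilizer_def)

lemma level_stabilizer_normal: "level_stabilizer T G \<phi> i \<lhd> G"
  unfolding normal_inv_iff
proof (intro conjI ballI)
  have lV: "u \<in> verts T" if "u \<in> level T i" for u using that by (simp add: level_def)
  show "subgroup (level_stabilizer T G \<phi> i) G"
  proof (rule subgroupI)
    fix a assume a: "a \<in> level_stabilizer T G \<phi> i"
    then have aG: "a \<in> carrier G" by (simp add: level_stabilizer_iff)
    have "\<phi> (inv a) u = u" if "u \<in> level T i" for u
      using act_inv(1)[OF aG lV[OF that]] a that by (simp add: level_stabilizer_iff)
    then show "inv a \<in> level_stabilizer T G \<phi> i" using aG by (simp add: level_stabilizer_iff)
  next
    have "\<one> \<in> level_stabilizer T G \<phi> i" by (simp add: level_stabilizer_iff act_one lV)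
    then show "level_stabilizer T G \<phi> i \<noteq> {}" by blast
  qed (auto simp: level_stabilizer_iff act_mult lV)
  fix x h assume x: "x \<in> carrier G" and h: "h \<in> level_stabilizer T G \<phi> i"
  have hG: "h \<in> carrier G" using h by (simp add: level_stabilizer_iff)
  have "\<phi> (x \<otimes> h \<otimes> inv x) u = u" if u: "u \<in> level T i" for u
  proof -
    have "\<phi> (inv x) u \<in> level T i" using aut_level[OF act_aut u] x by simp
    then have "\<phi> h (\<phi> (inv x) u) = \<phi> (inv x) u" using h by (simp add: level_stabilizer_iff)
    then show ?thesis using x hG lV[OF u] by (simp add: act_mult act_mem act_inv)
  qed
  then show "x \<otimes> h \<otimes> inv x \<in> level_stabilizer T G \<phi> i"
    using x hG by (simp add: level_stabilizer_iff)
qed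

lemma level_proj_eq:
  assumes a: "a \<in> carrier G" and b: "b \<in> carrier G"
    and eq: "\<And>u. u \<in> level T i \<Longrightarrow> \<phi> a u = \<phi> b u"
  shows "level_proj T G \<phi> i a = level_proj T G \<phi> i b"
proof -
  let ?K = "level_stabilizer T G \<phi> i"
  have lV: "u \<in> verts T" if "u \<in> level T i" for u using that by (simp add: level_def)
  have "\<phi> (b \<otimes> inv a) u = u" if u: "u \<in> level T i" for u
  proof -
    have "\<phi> (inv a) u \<in> level T i" using aut_level[OF act_aut u] a by simp
    then have "\<phi> b (\<phi> (inv a) u) = \<phi> a (\<phi> (inv a) u)" using eq by simp
    then show ?thesis using a b lV[OF u] by (simp add: act_mult act_inv)
  qed
  then have "b \<otimes> inv a \<in> ?K" using a b by (simp add: level_stabilizer_iff)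
  moreover have "b = (b \<otimes> inv a) \<otimes> a" using a b by (simp add: m_assoc)
  ultimately have "b \<in> ?K #> a" unfolding r_coset_def by blast
  then show ?thesis
    unfolding level_proj_def using a level_stabilizer_normal
    by (intro repr_independence) (auto simp: normal_imp_subgroup)
qed

text \<open>
  On level \<open>n + 1\<close>, the groups \<open>G\<^bsub>{v}\<^esub>\<close> for distinct \<open>v\<close> move disjoint sets of vertices, so all
  factors of the elements of \<open>\<Gamma>\<close> commute modulo the level stabilizer.
\<close>

lemma Gamma_abelian_if_local_abelian:
  assumes comm: "\<And>v a b u. v \<in> level T n \<Longrightarrow> a \<in> local_subgroup T G \<phi> v \<Longrightarrow> b \<in> local_subgroup T G \<phi> v \<Longrightarrow>
    u \<in> children T v \<Longrightarrow> \<phi> a (\<phi> b u) = \<phi> b (\<phi> a u)"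
  shows "abelian_subset (level_quotient T G \<phi> (Suc n)) (Gamma T G \<phi> (Suc n))"
proof -
  let ?i = "Suc n"
  let ?Q = "level_quotient T G \<phi> ?i" and ?p = "level_proj T G \<phi> ?i"
  interpret K: normal "level_stabilizer T G \<phi> ?i" G by (rule level_stabilizer_normal)
  interpret Q: group ?Q unfolding level_quotient_def by (rule K.factorgroup_is_group)
  have lV: "u \<in> verts T" if "u \<in> level T k" for u k using that by (simp add: level_def)
  have pc: "?p a \<in> carrier ?Q" if "a \<in> carrier G" for a
    using that unfolding level_proj_def level_quotient_def FactGroup_def RCOSETS_def by auto
  have pm: "?p a \<otimes>\<^bsub>?Q\<^esub> ?p b = ?p (a \<otimes> b)" if "a \<in> carrier G" "b \<in> carrier G" for a b
    using that K.rcos_sum by (simp add: level_proj_def level_quotient_def FactGroup_def)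
  have L: "a \<in> carrier G" "\<phi> a v = v"
    "u \<in> level T ?i \<Longrightarrow> parent T u \<noteq> v \<Longrightarrow> \<phi> a u = u"
    if "v \<in> level T n" "a \<in> local_subgroup T G \<phi> v" for v a u
    using that local_subgroup_iff by blast+
  have pcomm: "?p a \<otimes>\<^bsub>?Q\<^esub> ?p b = ?p b \<otimes>\<^bsub>?Q\<^esub> ?p a"
    if v: "v \<in> level T n" and a: "a \<in> local_subgroup T G \<phi> v"
      and w: "w \<in> level T n" and b: "b \<in> local_subgroup T G \<phi> w" for v w a b
  proof -
    note A = L[OF v a] and B = L[OF w b]
    have "\<phi> a (\<phi> b u) = \<phi> b (\<phi> a u)" if u: "u \<in> level T ?i" for u
    proof -
      have par: "parent T (\<phi> a u) = \<phi> a (parent T u)" "parent T (\<phi> b u) = \<phi> b (parent T u)"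
        "\<phi> a u \<in> level T ?i" "\<phi> b u \<in> level T ?i"
        using aut_parent[OF act_aut lV[OF u]] aut_level[OF act_aut u] A(1) B(1) by auto
      consider "parent T u = v" "parent T u = w" | "parent T u = v" "v \<noteq> w"
        | "parent T u = w" "v \<noteq> w" | "parent T u \<noteq> v" "parent T u \<noteq> w" by blast
      then show ?thesis
      proof cases
        case 1
        moreover have "u \<in> children T v" using 1 u by (auto simp: children_iff_depth level_def)
        ultimately show ?thesis using comm[OF v a] b by blast
      next
        case 2
        then show ?thesis using par A(2) B(3)[OF u] B(3)[OF par(3)] by auto
      next
        case 3
        then show ?thesis using par B(2) A(3)[OF u] A(3)[OF par(4)] by auto
      next
        case 4
        then show ?thesis using A(3)[OF u] B(3)[OF u] by simp
      qed
    qed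
    then have "?p (a \<otimes> b) = ?p (b \<otimes> a)"
      using A(1) B(1) lV by (intro level_proj_eq) (simp_all add: act_mult)
    then show ?thesis using pm A(1) B(1) by simp
  qed
  show ?thesis
    unfolding abelian_subset_def
  proof (intro ballI)
    have lst: "\<exists>xs. x = foldr (\<lambda>a c. a \<otimes>\<^bsub>?Q\<^esub> c) xs \<one>\<^bsub>?Q\<^esub> \<and>
        set xs \<subseteq> (\<Union>v\<in>level T n. ?p ` local_subgroup T G \<phi> v)" if "x \<in> Gamma T G \<phi> ?i" for x
      using that unfolding Gamma_def by fastforce
    fix x y assume "x \<in> Gamma T G \<phi> ?i" "y \<in> Gamma T G \<phi> ?i"
    then obtain xs ys where
      xs: "x = foldr (\<lambda>a c. a \<otimes>\<^bsub>?Q\<^esub> c) xs \<one>\<^bsub>?Q\<^esub>" "set xs \<subseteq> (\<Union>v\<in>level T n. ?p ` local_subgroup T G \<phi> v)" and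
      ys: "y = foldr (\<lambda>a c. a \<otimes>\<^bsub>?Q\<^esub> c) ys \<one>\<^bsub>?Q\<^esub>" "set ys \<subseteq> (\<Union>v\<in>level T n. ?p ` local_subgroup T G \<phi> v)"
      using lst by meson
    have sub: "(\<Union>v\<in>level T n. ?p ` local_subgroup T G \<phi> v) \<subseteq> carrier ?Q" using L(1) pc by blast
    show "x \<otimes>\<^bsub>?Q\<^esub> y = y \<otimes>\<^bsub>?Q\<^esub> x"
      unfolding xs(1) ys(1)
    proof (rule Q.foldr_mult_commute)
      fix a b assume "a \<in> set xs" "b \<in> set ys"
      then have "a \<in> (\<Union>v\<in>level T n. ?p ` local_subgroup T G \<phi> v)"
        "b \<in> (\<Union>v\<in>level T n. ?p ` local_subgroup T G \<phi> v)" using xs ys by blast+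
      then show "a \<otimes>\<^bsub>?Q\<^esub> b = b \<otimes>\<^bsub>?Q\<^esub> a" using pcomm by auto
    qed (use xs ys sub in auto)
  qed
qed

end

section \<open>The property \<open>R\<^sub>\<infinity>\<close>\<close>

lemma (in rooted) finite_levels:
  assumes "spherically_symmetric T b"
  shows "finite (level T n)"
proof (induction n)
  case 0
  have "level T 0 \<subseteq> {root T}" using depth_0_iff by (auto simp: level_def)
  then show ?case by (rule finite_subset) simp
next
  case (Suc n)
  have "level T (Suc n) \<subseteq> (\<Union>v\<in>level T n. children T v)"
    by (auto simp: level_def children_iff_depth depth_parent' parent_mem)
  moreover have "finite (\<Union>v\<in>level T n. children T v)"
    using Suc assms by (auto simp: spherically_symmetric_def)
  ultimately show ?case by (rule finite_subset)
qed

context weakly_branch_action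
begin

lemma twisted_weakly_branch:
  assumes \<alpha>: "\<alpha> \<in> iso G G"
  shows "weakly_branch_action T G (\<phi> \<circ> \<alpha>)"
proof
  have hom: "\<alpha> \<in> hom G G" and bij: "bij_betw \<alpha> (carrier G) (carrier G)"
    using \<alpha> by (auto simp: iso_def)
  have \<alpha>G: "\<alpha> g \<in> carrier G" if "g \<in> carrier G" for g using hom that by (rule hom_in_carrier)
  show "faithful_tree_action T G (\<phi> \<circ> \<alpha>)"
    unfolding faithful_tree_action_def
  proof (intro conjI ballI)
    have "\<phi> \<circ> \<alpha> \<in> hom G (BijGroup (verts T))"
      using hom group_hom.homh[OF action.group_hom] by (rule Group.hom_compose)
    moreover have "inj_on (\<phi> \<circ> \<alpha>) (carrier G)"
      using bij faithful
      by (auto simp: bij_betw_def faithful_tree_action_def faithful_action_def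
          faithful_action_axioms_def intro: comp_inj_on)
    ultimately show "faithful_action G (verts T) (\<phi> \<circ> \<alpha>)"
      using action.group_hom
      by (auto simp: faithful_action_def faithful_action_axioms_def group_action_def group_hom_def
          group_hom_axioms_def)
    show "tree_automorphism T ((\<phi> \<circ> \<alpha>) g)" if "g \<in> carrier G" for g
      using act_aut[OF \<alpha>G[OF that]] by simp
  qed
  show "\<exists>g\<in>rist T G (\<phi> \<circ> \<alpha>) v. g \<noteq> \<one>" if v: "v \<in> verts T" for v
  proof -
    obtain g where g: "g \<in> rist T G \<phi> v" "g \<noteq> \<one>" using rist_nontrivial[OF v] by blast
    then obtain k where k: "k \<in> carrier G" "\<alpha> k = g"
      using bij ristD(1) unfolding bij_betw_def by (metis imageE)
    then have "k \<in> rist T G (\<phi> \<circ> \<alpha>) v" using g by (simp add: rist_def)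
    moreover have "k \<noteq> \<one>" using k g hom by (metis hom_one is_group)
    ultimately show ?thesis by blast
  qed
qed

lemma characteristic_normal:
  assumes "characteristic_subgroup H G"
  shows "H \<lhd> G"
  unfolding normal_inv_iff
proof (intro conjI ballI)
  show "subgroup H G" using assms by (simp add: characteristic_subgroup_def)
  fix x h assume x: "x \<in> carrier G" and h: "h \<in> H"
  have cancel: "inv x \<otimes> (x \<otimes> a) = a" "x \<otimes> (inv x \<otimes> a) = a" if "a \<in> carrier G" for a
    using x that by (simp_all flip: m_assoc)
  have "(\<lambda>g. x \<otimes> g \<otimes> inv x) \<in> iso G G"
    unfolding iso_def hom_def
  proof (intro CollectI conjI)
    show "bij_betw (\<lambda>g. x \<otimes> g \<otimes> inv x) (carrier G) (carrier G)"
      by (rule bij_betw_byWitness[where f' = "\<lambda>g. inv x \<otimes> g \<otimes> x"])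
        (use x in \<open>auto simp: m_assoc cancel\<close>)
  qed (use x in \<open>auto simp: m_assoc cancel\<close>)
  then have "(\<lambda>g. x \<otimes> g \<otimes> inv x) ` H = H" using assms by (simp add: characteristic_subgroup_def)
  then show "x \<otimes> h \<otimes> inv x \<in> H" using h by blast
qed

text \<open>
  The subgroups \<open>H\<^sub>n\<close> are characteristic, so they are saturating for the action twisted by \<open>\<alpha>\<close> as
  well, and the two actions are conjugate.
\<close>

theorem automorphism_induced:
  assumes sat: "saturated T G \<phi>" and \<alpha>: "\<alpha> \<in> iso G G"
  shows "\<exists>s. tree_automorphism T s \<and> (\<forall>g\<in>carrier G. \<forall>v\<in>verts T. s (\<phi> g v) = \<phi> (\<alpha> g) (s v))"
proof -
  have common: "\<exists>H. saturating T G \<phi> n H \<and> saturating T G (\<phi> \<circ> \<alpha>) n H" if "1 \<le> n" for n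
  proof -
    have "\<exists>H. characteristic_subgroup H G \<and> (\<forall>h\<in>H. \<forall>v\<in>level T n. \<phi> h v = v) \<and>
      (\<forall>v\<in>level T n. level_transitive_on_subtree T \<phi> H v)"
      using sat that unfolding saturated_def by simp
    then obtain H where H: "characteristic_subgroup H G" "\<forall>h\<in>H. \<forall>v\<in>level T n. \<phi> h v = v"
      "\<forall>v\<in>level T n. level_transitive_on_subtree T \<phi> H v"
      by blast
    have im: "\<alpha> ` H = H" using H(1) \<alpha> by (simp add: characteristic_subgroup_def)
    have "transitive_on (\<phi> \<circ> \<alpha>) H S \<longleftrightarrow> transitive_on \<phi> (\<alpha> ` H) S" for S
      by (auto simp: transitive_on_def)
    then have "level_transitive_on_subtree T (\<phi> \<circ> \<alpha>) H v \<longleftrightarrow> level_transitive_on_subtree T \<phi> H v" for v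
      by (simp add: level_transitive_on_subtree_def im)
    moreover have "\<forall>h\<in>H. \<forall>v\<in>level T n. (\<phi> \<circ> \<alpha>) h v = v" using H(2) im by fastforce
    ultimately show ?thesis
      using H characteristic_normal[OF H(1)] unfolding saturating_def by blast
  qed
  interpret twisted: weakly_branch_action T G "\<phi> \<circ> \<alpha>" by (rule twisted_weakly_branch[OF \<alpha>])
  interpret pair: weakly_branch_pair T G \<phi> "\<phi> \<circ> \<alpha>" by unfold_locales (rule common)
  show ?thesis using pair.intertwining_automorphism by simp
qed

end

lemma not_abelian_Gamma_witness:
  assumes "tree_action T G \<phi>" "\<not> abelian_subset (level_quotient T G \<phi> (Suc n)) (Gamma T G \<phi> (Suc n))"
  obtains v a b u where "v \<in> level T n" "a \<in> local_subgroup T G \<phi> v" "b \<in> local_subgroup T G \<phi> v"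
    "u \<in> children T v" "\<phi> a (\<phi> b u) \<noteq> \<phi> b (\<phi> a u)"
  using tree_action.Gamma_abelian_if_local_abelian[OF assms(1), of n] assms(2) by blast

theorem theorem4p2:
  fixes T :: "'v rtree"
    and b :: "nat \<Rightarrow> nat"
    and G :: "('g, 'm) monoid_scheme"
    and \<phi> :: "'g \<Rightarrow> 'v \<Rightarrow> 'v"
  assumes "rooted_tree T"
    and "spherically_symmetric T b"
    and "\<And>n. prime (b n)"
    and "group G"
    and "finitely_generated_group G"
    and "weakly_branch T G \<phi>"
    and "saturated T G \<phi>"
    and "level_transitive T G \<phi>"
    and "weakly_stabilizer_transitive T G \<phi>"
    and "infinite {i. i \<ge> 1 \<and>
           (\<forall>v\<in>level T (i - 1). transitive_on \<phi> (local_subgroup T G \<phi> v) (children T v)) \<and>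
           \<not> abelian_subset (level_quotient T G \<phi> i) (Gamma T G \<phi> i)}"
  shows "R_infinity_group G"
proof -
  interpret rooted T by unfold_locales (rule assms)
  interpret group G by (rule assms)
  interpret weakly_branch_action T G \<phi>
  proof
    show "children T v \<noteq> {}" if "v \<in> verts T" for v
    proof -
      have "card (children T v) = b (depth T v)"
        using assms(2) that by (simp add: spherically_symmetric_def level_def)
      then show ?thesis using assms(3)[of "depth T v"] by auto
    qed
    show "faithful_tree_action T G \<phi>" using assms(6) by (simp add: weakly_branch_def)
    then interpret ga: group_action G "verts T" \<phi>
      by (simp add: faithful_tree_action_def faithful_action_def)
    show "\<exists>g\<in>rist T G \<phi> v. g \<noteq> \<one>\<^bsub>G\<^esub>" if v: "v \<in> verts T" for v
    proof -
      obtain g u where "g \<in> carrier G" "u \<in> subtree T v" "\<phi> g u \<noteq> u"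
        "\<forall>u\<in>verts T - subtree T v. \<phi> g u = u"
        using assms(6) v unfolding weakly_branch_def by blast
      moreover have "\<phi> \<one>\<^bsub>G\<^esub> u = u" using \<open>u \<in> subtree T v\<close> ga.id_eq_one subtreeD(1) by (metis restrict_apply')
      ultimately show ?thesis unfolding rist_def by (intro bexI[of _ g]) auto
    qed
  qed
  have fin: "finite (level T n)" for n using finite_levels[OF assms(2)] .
  define I where "I = {i. i \<ge> 1 \<and>
           (\<forall>v\<in>level T (i - 1). transitive_on \<phi> (local_subgroup T G \<phi> v) (children T v)) \<and>
           \<not> abelian_subset (level_quotient T G \<phi> i) (Gamma T G \<phi> i)}"
  have infI: "infinite I" using assms(10) by (simp add: I_def)
  show ?thesis
    unfolding R_infinity_group_def
  proof
    fix \<alpha> assume \<alpha>: "\<alpha> \<in> iso G G"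
    have hom: "\<alpha> \<in> hom G G" using \<alpha> by (auto simp: iso_def)
    have \<alpha>G: "\<alpha> g \<in> carrier G" if "g \<in> carrier G" for g using hom that by (rule hom_in_carrier)
    obtain s where s: "tree_automorphism T s"
      "\<And>g v. g \<in> carrier G \<Longrightarrow> v \<in> verts T \<Longrightarrow> s (\<phi> g v) = \<phi> (\<alpha> g) (s v)"
      using automorphism_induced[OF assms(7) \<alpha>] by blast
    have ns: "normalises_action s" using s \<alpha>G unfolding normalises_action_def by blast
    have "\<exists>e. e \<in> carrier G \<and> (\<forall>w\<in>verts T. depth T w < i \<longrightarrow> \<phi> e w = w) \<and>
        (\<forall>h\<in>carrier G. \<exists>u\<in>level T i. \<phi> h (s u) \<noteq> s (\<phi> e (\<phi> h u)))" if i: "i \<in> I" for i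
    proof -
      obtain n where n: "i = Suc n" using i by (cases i) (auto simp: I_def)
      have nonab: "\<not> abelian_subset (level_quotient T G \<phi> (Suc n)) (Gamma T G \<phi> (Suc n))"
        using i by (simp add: I_def n)
      obtain v a c u where v: "v \<in> level T n" "a \<in> local_subgroup T G \<phi> v" "c \<in> local_subgroup T G \<phi> v"
        "u \<in> children T v" "\<phi> a (\<phi> c u) \<noteq> \<phi> c (\<phi> a u)"
        by (rule not_abelian_Gamma_witness[OF tree_action_axioms nonab])
      have tr: "transitive_on \<phi> (local_subgroup T G \<phi> v) (children T v)"
        using i v(1) by (simp add: I_def n)
      have card: "card (children T v) = b n" using assms(2) v(1) by (simp add: spherically_symmetric_def)
      obtain e where e: "e \<in> local_subgroup T G \<phi> v"
        "\<forall>h\<in>carrier G. \<exists>u\<in>level T (Suc n). \<phi> h (s u) \<noteq> s (\<phi> e (\<phi> h u))"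
        using level_class_splits[OF v(1) fin ns assms(3) card tr v(2-5)] by blast
      have "e \<in> carrier G" using e(1) local_subgroup_iff[OF v(1)] by blast
      then show ?thesis using e local_subgroup_fixes[OF e(1) v(1)] n by auto
    qed
    then obtain e where e: "\<And>i. i \<in> I \<Longrightarrow> e i \<in> carrier G"
      "\<And>i w. i \<in> I \<Longrightarrow> w \<in> verts T \<Longrightarrow> depth T w < i \<Longrightarrow> \<phi> (e i) w = w"
      "\<And>i h. i \<in> I \<Longrightarrow> h \<in> carrier G \<Longrightarrow> \<exists>u\<in>level T i. \<phi> h (s u) \<noteq> s (\<phi> (e i) (\<phi> h u))"
      by metis
    let ?R = "twisted_conjugacy G \<alpha>"
    have refl: "(g, g) \<in> ?R" if "g \<in> carrier G" for g
      using that hom hom_one[OF hom assms(4) assms(4)]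
      by (auto simp: twisted_conjugacy_def intro!: bexI[of _ "\<one>\<^bsub>G\<^esub>"])
    \<comment> \<open>A twisting element \<open>h\<close> would conjugate \<open>s (e j)\<close> into \<open>s (e i)\<close> on the tree; on level \<open>i\<close> the
      former is \<open>s\<close>, which contradicts the choice of \<open>e i\<close>.\<close>
    have distinct: "?R `` {\<alpha> (e i)} \<noteq> ?R `` {\<alpha> (e j)}" if i: "i \<in> I" and j: "j \<in> I" and ij: "i < j" for i j
    proof
      assume "?R `` {\<alpha> (e i)} = ?R `` {\<alpha> (e j)}"
      then have "(\<alpha> (e j), \<alpha> (e i)) \<in> ?R" using refl[OF \<alpha>G[OF e(1)[OF i]]] by blast
      then obtain h where h: "h \<in> carrier G"
        "\<alpha> (e i) = h \<otimes>\<^bsub>G\<^esub> \<alpha> (e j) \<otimes>\<^bsub>G\<^esub> \<alpha> (inv\<^bsub>G\<^esub> h)"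
        by (auto simp: twisted_conjugacy_def)
      obtain u where u: "u \<in> level T i" "\<phi> h (s u) \<noteq> s (\<phi> (e i) (\<phi> h u))" using e(3)[OF i h(1)] by blast
      have uV: "u \<in> verts T" "depth T u < j" using u ij by (auto simp: level_def)
      have hu: "\<phi> h u \<in> verts T" using act_mem h uV by blast
      have G: "\<alpha> (e j) \<in> carrier G" "\<alpha> (inv\<^bsub>G\<^esub> h) \<in> carrier G" using \<alpha>G e(1)[OF j] h by auto
      have "s (\<phi> (e i) (\<phi> h u)) = \<phi> (\<alpha> (e i)) (s (\<phi> h u))" using s(2) e(1)[OF i] hu by blast
      also have "\<dots> = \<phi> h (\<phi> (\<alpha> (e j)) (\<phi> (\<alpha> (inv\<^bsub>G\<^esub> h)) (s (\<phi> h u))))"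
        unfolding h(2) using h(1) G aut_mem[OF s(1) hu] by (simp add: act_mult act_mem)
      also have "\<phi> (\<alpha> (inv\<^bsub>G\<^esub> h)) (s (\<phi> h u)) = s u"
        using s(2)[of "inv\<^bsub>G\<^esub> h" "\<phi> h u"] h(1) hu act_inv uV by simp
      also have "\<phi> (\<alpha> (e j)) (s u) = s u" using s(2)[OF e(1)[OF j] uV(1)] e(2)[OF j uV] by simp
      finally show False using u by simp
    qed
    have "inj_on (\<lambda>i. ?R `` {\<alpha> (e i)}) I"
      unfolding inj_on_def using distinct by (metis linorder_neqE_nat)
    moreover have "(\<lambda>i. ?R `` {\<alpha> (e i)}) ` I \<subseteq> carrier G // ?R"
      using \<alpha>G e(1) by (auto intro: quotientI)
    ultimately have "infinite (carrier G // ?R)"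
      using infI by (metis finite_imageD finite_subset)
    then show "reidemeister_number G \<alpha> = \<infinity>" by (simp add: reidemeister_number_def)
  qed
qed

end
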